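(* Let $f\in\mathbb{C}[\mathbf{x}]=\mathbb{C}[x_1,\dots,x_n]$ be a non-zero polynomial with global Bernstein-Sato polynomial $b_f(s)$. Let $\{P_1(s),\dots,P_k(s),f\}$ be a system of generators of the left ideal $I=\operatorname{Ann}_{D[s]}(f^s)+D[s]\langle f\rangle$ of $D[s]$. Let $\alpha$ be a root of $b_f(-s)$ with multiplicity $m_\alpha$, and for $i=0,\dots,m_\alpha-1$ consider the left ideals $I_{\alpha,i}=\big(I:(s+\alpha)^i\big)+D[s]\langle s+\alpha\rangle$. For $p\in\mathbb{C}^n$ let $m_\alpha(p)$ be the multiplicity of $\alpha$ as a root of $b_{f,p}(-s)$, where $b_{f,p}(s)$ is the local $b$-function of $f$ at $p$ (with $m_\alpha(p)=0$ if $\alpha$ is not a root). Then for every $p\in\mathbb{C}^n$ and every $i=0,\dots,m_\alpha-1$, $$m_\alpha(p)>i\iff p\in V(I_{\alpha,i}\cap\mathbb{C}[\mathbf{x}]).$$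
   Context: $D$ is the $n$-th Weyl algebra over $\mathbb{C}$, generated by $x_1,\dots,x_n,\partial_1,\dots,\partial_n$ with relations $\partial_i x_j=x_j\partial_i+\delta_{ij}$, $x_jx_i=x_ix_j$, $\partial_j\partial_i=\partial_i\partial_j$; $D[s]=D\otimes_{\mathbb{C}}\mathbb{C}[s]$ (so $s$ is central). $D[s]\langle\dots\rangle$ is the left ideal generated by the listed elements, and for a left ideal $I\subseteq D[s]$ and $q\in\mathbb{C}[s]$, $I:q=\{P\in D[s]\mid qP\in I\}$. $\mathbb{C}[\mathbf{x}][s,\frac1f]\cdot f^s$ is the free module of rank one on the symbol $f^s$, a left $D[s]$-module via $\partial_i(g\cdot f^s)=\big(\frac{\partial g}{\partial x_i}+s\,g\,\frac{\partial f}{\partial x_i}\frac1f\big)\cdot f^s$, and $\operatorname{Ann}_{D[s]}(f^s)$ is the left ideal of all $P(s)\in D[s]$ with $P(s)\cdot f^s=0$. The global Bernstein-Sato polynomial $b_f(s)$ is the monic polynomial of minimal degree for which there is $P(s)\in D[s]$ with $P(s)f\cdot f^s=b_f(s)\cdot f^s$. $V(\mathfrak{a})\subseteq\mathbb{C}^n$ is the zero set of an ideal $\mathfrak{a}\subseteq\mathbb{C}[\mathbf{x}]$. For $p\in\mathbb{C}^n$, $\mathfrak{m}_p=\langle x_1-p_1,\dots,x_n-p_n\rangle$, $\mathbb{C}[\mathbf{x}]_p$ is the localization of $\mathbb{C}[\mathbf{x}]$ at $\mathfrak{m}_p$, and $D_p$ is the local Weyl algebra at $p$, i.e. the Weyl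 algebra with coefficients in $\mathbb{C}[\mathbf{x}]_p$ instead of $\mathbb{C}[\mathbf{x}]$; $D_p[s]=D_p\otimes_{\mathbb{C}}\mathbb{C}[s]$ acts on $\mathbb{C}[\mathbf{x}]_p[s,\frac1f]\cdot f^s$ by the same formula. The local $b$-function $b_{f,p}(s)\in\mathbb{C}[s]$ is the monic polynomial of minimal degree for which there exists $P_p(s)\in D_p[s]$ with $P_p(s)f\cdot f^s=b_{f,p}(s)\cdot f^s$. *)

theory Defs
  imports
    "HOL-Library.Poly_Mapping"
    "HOL-Computational_Algebra.Polynomial_Factorial"
    "HOL-Analysis.Finite_Cartesian_Product"
begin

section \<open>Polynomials and rational functions\<close>

text \<open>
  The variables are indexed by a finite linearly ordered type \<open>'n\<close>, so that \<open>n = CARD('n)\<close>.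
  A polynomial maps exponent vectors to coefficients; multiplication is convolution.
  The order on \<open>'n\<close> is only needed to make the library recognise the polynomial ring as an
  integral domain, and to list the variables in a definite order.
\<close>

type_synonym 'n mpoly = "('n \<Rightarrow>\<^sub>0 nat) \<Rightarrow>\<^sub>0 complex"
type_synonym 'n mfrac = "'n mpoly fract"

definition Const :: "complex \<Rightarrow> 'n mpoly" where
  "Const c = Poly_Mapping.single 0 c"

definition Var :: "'n \<Rightarrow> 'n mpoly" where
  "Var i = Poly_Mapping.single (Poly_Mapping.single i 1) 1"

definition mpoly_eval :: "complex ^ 'n::finite \<Rightarrow> 'n mpoly \<Rightarrow> complex" where
  "mpoly_eval p g =
     (\<Sum>m\<in>Poly_Mapping.keys g. Poly_Mapping.lookup g m * (\<Prod>i\<in>UNIV. (p $ i) ^ Poly_Mapping.lookup m i))"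

definition mpoly_deriv :: "'n \<Rightarrow> 'n mpoly \<Rightarrow> 'n mpoly" where
  "mpoly_deriv i g =
     (\<Sum>m\<in>Poly_Mapping.keys g. Poly_Mapping.single (m - Poly_Mapping.single i 1)
        (of_nat (Poly_Mapping.lookup m i) * Poly_Mapping.lookup g m))"

lemma pm_sum_single: "(\<Sum>m\<in>Poly_Mapping.keys g. Poly_Mapping.single m (Poly_Mapping.lookup g m)) = g"
  by (rule poly_mapping_eqI)
     (auto simp: lookup_sum lookup_single when_def sum.delta' in_keys_iff)

lemma pm_induct [case_names single add]:
  fixes g :: "'a \<Rightarrow>\<^sub>0 'b::comm_monoid_add"
  assumes s: "\<And>m c. P (Poly_Mapping.single m c)" and a: "\<And>g h. P g \<Longrightarrow> P h \<Longrightarrow> P (g + h)"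
  shows "P g"
proof -
  have "finite A \<Longrightarrow> P (\<Sum>m\<in>A. Poly_Mapping.single m (Poly_Mapping.lookup g m))" for A
    by (induction A rule: finite_induct) (auto intro: a s simp: s[of undefined 0, simplified])
  from this[of "Poly_Mapping.keys g"] show ?thesis by (simp add: pm_sum_single)
qed

lemma pm_sum_superset:
  assumes "finite A" "Poly_Mapping.keys g \<subseteq> A" "\<And>m. h m 0 = 0"
  shows "(\<Sum>m\<in>Poly_Mapping.keys g. h m (Poly_Mapping.lookup g m)) = (\<Sum>m\<in>A. h m (Poly_Mapping.lookup g m))"
  using assms by (intro sum.mono_neutral_left) (auto simp: in_keys_iff)

lemma pm_sum_add:
  fixes h :: "'a \<Rightarrow> 'b::comm_monoid_add \<Rightarrow> 'c::comm_monoid_add"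
  assumes h0: "\<And>m. h m 0 = 0"
    and ha: "\<And>m. h m (Poly_Mapping.lookup g m + Poly_Mapping.lookup g' m)
       = h m (Poly_Mapping.lookup g m) + h m (Poly_Mapping.lookup g' m)"
  shows "(\<Sum>m\<in>Poly_Mapping.keys (g + g'). h m (Poly_Mapping.lookup (g + g') m))
     = (\<Sum>m\<in>Poly_Mapping.keys g. h m (Poly_Mapping.lookup g m)) + (\<Sum>m\<in>Poly_Mapping.keys g'. h m (Poly_Mapping.lookup g' m))"
proof -
  let ?A = "Poly_Mapping.keys g \<union> Poly_Mapping.keys g'"
  have "(\<Sum>m\<in>Poly_Mapping.keys (g + g'). h m (Poly_Mapping.lookup (g + g') m))
      = (\<Sum>m\<in>?A. h m (Poly_Mapping.lookup (g + g') m))"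
    by (rule pm_sum_superset) (use h0 Poly_Mapping.keys_add[of g g'] in auto)
  moreover have "(\<Sum>m\<in>Poly_Mapping.keys g. h m (Poly_Mapping.lookup g m)) = (\<Sum>m\<in>?A. h m (Poly_Mapping.lookup g m))"
    by (rule pm_sum_superset) (use h0 in auto)
  moreover have "(\<Sum>m\<in>Poly_Mapping.keys g'. h m (Poly_Mapping.lookup g' m)) = (\<Sum>m\<in>?A. h m (Poly_Mapping.lookup g' m))"
    by (rule pm_sum_superset) (use h0 in auto)
  ultimately show ?thesis by (simp add: lookup_add ha sum.distrib)
qed

lemma pm_sum_on_single:
  assumes "\<And>m. h m 0 = 0"
  shows "(\<Sum>m\<in>Poly_Mapping.keys (Poly_Mapping.single a c). h m (Poly_Mapping.lookup (Poly_Mapping.single a c) m)) = h a c"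
  using assms by (simp add: lookup_single)

lemma mpoly_deriv_add: "mpoly_deriv i (g + h) = mpoly_deriv i g + mpoly_deriv i h"
  unfolding mpoly_deriv_def by (rule pm_sum_add) (auto simp: algebra_simps single_add)

lemma mpoly_deriv_single:
  "mpoly_deriv i (Poly_Mapping.single m c)
     = Poly_Mapping.single (m - Poly_Mapping.single i 1) (of_nat (Poly_Mapping.lookup m i) * c)"
  unfolding mpoly_deriv_def by (rule pm_sum_on_single) simp

lemma mpoly_deriv_0 [simp]: "mpoly_deriv i 0 = 0"
  by (simp add: mpoly_deriv_def)

lemma mpoly_deriv_uminus: "mpoly_deriv i (- g) = - mpoly_deriv i g"
  using mpoly_deriv_add[of i g "- g"] by (simp add: minus_unique)

lemma mpoly_deriv_Const [simp]: "mpoly_deriv i (Const c) = 0"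
  by (simp add: Const_def mpoly_deriv_single)

lemma mpoly_deriv_1 [simp]: "mpoly_deriv i 1 = 0"
  using mpoly_deriv_Const[of i 1] by (simp add: Const_def)

lemma mpoly_deriv_Var: "mpoly_deriv i (Var j) = (if i = j then 1 else 0)"
  by (simp add: Var_def mpoly_deriv_single lookup_single when_def)

lemma exp_minus_add:
  fixes m m' :: "'n \<Rightarrow>\<^sub>0 nat"
  assumes "Poly_Mapping.lookup m i \<noteq> 0"
  shows "m - Poly_Mapping.single i 1 + m' = m + m' - Poly_Mapping.single i 1"
  using assms by (intro poly_mapping_eqI) (auto simp: lookup_add lookup_minus lookup_single when_def)

lemma mpoly_deriv_mult: "mpoly_deriv i (g * h) = mpoly_deriv i g * h + g * mpoly_deriv i h"
proof (induction g rule: pm_induct)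
  case (single m c)
  show ?case
  proof (induction h rule: pm_induct)
    case (single m' c')
    have 1: "Poly_Mapping.single (m - Poly_Mapping.single i 1 + m') (of_nat (Poly_Mapping.lookup m i) * c * c')
        = Poly_Mapping.single (m + m' - Poly_Mapping.single i 1) (of_nat (Poly_Mapping.lookup m i) * c * c')"
      by (cases "Poly_Mapping.lookup m i = 0") (simp_all add: exp_minus_add del: One_nat_def)
    have 2: "Poly_Mapping.single (m + (m' - Poly_Mapping.single i 1)) (c * (of_nat (Poly_Mapping.lookup m' i) * c'))
        = Poly_Mapping.single (m + m' - Poly_Mapping.single i 1) (c * (of_nat (Poly_Mapping.lookup m' i) * c'))"
      using exp_minus_add[of m' i m]
      by (cases "Poly_Mapping.lookup m' i = 0") (simp_all add: add.commute del: One_nat_def)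
    show ?case
      unfolding mult_single mpoly_deriv_single 1 2 single_add[symmetric]
      by (simp add: lookup_add algebra_simps)
  next
    case (add h h')
    then show ?case by (simp add: mpoly_deriv_add algebra_simps)
  qed
next
  case (add g g')
  then show ?case by (simp add: mpoly_deriv_add algebra_simps)
qed

lemma mpoly_deriv_commute: "mpoly_deriv i (mpoly_deriv j g) = mpoly_deriv j (mpoly_deriv i g)"
proof (cases "i = j")
  case False
  show ?thesis
  proof (induction g rule: pm_induct)
    case (single m c)
    have "m - Poly_Mapping.single j 1 - Poly_Mapping.single i 1 = m - Poly_Mapping.single i 1 - Poly_Mapping.single j 1"
      by (rule poly_mapping_eqI) (simp add: lookup_minus)
    with False show ?case
      by (simp add: mpoly_deriv_single lookup_minus lookup_single algebra_simps del: One_nat_def)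
  qed (simp add: mpoly_deriv_add)
qed simp

text \<open>The quotient rule; \<open>mfrac_deriv_Fract\<close> shows that the choice of fraction is irrelevant.\<close>

definition mfrac_deriv :: "'n::{finite,linorder} \<Rightarrow> 'n mfrac \<Rightarrow> 'n mfrac" where
  "mfrac_deriv i q = (THE d. \<exists>a b. b \<noteq> 0 \<and> q = Fract a b \<and>
     d = Fract (mpoly_deriv i a * b - a * mpoly_deriv i b) (b * b))"

lemma mfrac_deriv_Fract:
  assumes b: "b \<noteq> 0"
  shows "mfrac_deriv i (Fract a b) = Fract (mpoly_deriv i a * b - a * mpoly_deriv i b) (b * b)"
  unfolding mfrac_deriv_def
proof (rule the_equality)
  let ?d = "mpoly_deriv i"
  fix d
  assume "\<exists>a' b'. b' \<noteq> 0 \<and> Fract a b = Fract a' b' \<and> d = Fract (?d a' * b' - a' * ?d b') (b' * b')"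
  then obtain a' b' where nz: "b' \<noteq> 0" and e: "a * b' = a' * b"
    and d': "d = Fract (?d a' * b' - a' * ?d b') (b' * b')"
    using b by (auto simp: eq_fract)
  have d: "?d a * b' + a * ?d b' = ?d a' * b + a' * ?d b"
    using arg_cong[OF e, of ?d] by (simp add: mpoly_deriv_mult)
  have "(?d a * b - a * ?d b) * (b' * b') - (?d a' * b' - a' * ?d b') * (b * b)
      = b * b' * (?d a * b' - ?d a' * b) - (a * b') * ?d b * b' + (a' * b) * ?d b' * b"
    by (simp add: algebra_simps)
  also have "?d a * b' - ?d a' * b = a' * ?d b - a * ?d b'"
    using d by (simp add: algebra_simps)
  also have "b * b' * (a' * ?d b - a * ?d b') - (a * b') * ?d b * b' + (a' * b) * ?d b' * b
     = b' * ?d b * (a' * b - a * b') + b * ?d b' * (a' * b - a * b')"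
    by (simp add: algebra_simps)
  finally show "d = Fract (?d a * b - a * ?d b) (b * b)"
    using nz b e by (simp add: d' eq_fract)
qed (use b in blast)

lemma mfrac_deriv_to_fract [simp]: "mfrac_deriv i (to_fract g) = to_fract (mpoly_deriv i g)"
  by (simp add: to_fract_def mfrac_deriv_Fract)

lemma mfrac_deriv_0 [simp]: "mfrac_deriv i 0 = 0"
  using mfrac_deriv_to_fract[of i 0] by simp

lemma mfrac_deriv_1 [simp]: "mfrac_deriv i 1 = 0"
  using mfrac_deriv_to_fract[of i 1] by simp

lemma mfrac_deriv_add: "mfrac_deriv i (g + h) = mfrac_deriv i g + mfrac_deriv i h"
  by (cases g; cases h)
     (simp add: mfrac_deriv_Fract eq_fract mpoly_deriv_add mpoly_deriv_mult algebra_simps)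

lemma mfrac_deriv_mult: "mfrac_deriv i (g * h) = mfrac_deriv i g * h + g * mfrac_deriv i h"
  by (cases g; cases h)
     (simp add: mfrac_deriv_Fract eq_fract mpoly_deriv_add mpoly_deriv_mult algebra_simps)

lemma mfrac_deriv_uminus: "mfrac_deriv i (- g) = - mfrac_deriv i g"
  using mfrac_deriv_add[of i g "- g"] by (simp add: minus_unique)

lemma mfrac_deriv_diff: "mfrac_deriv i (g - h) = mfrac_deriv i g - mfrac_deriv i h"
  using mfrac_deriv_add[of i g "- h"] by (simp add: mfrac_deriv_uminus)

lemma mfrac_deriv_divide:
  assumes "h \<noteq> 0"
  shows "mfrac_deriv i (g / h) = (mfrac_deriv i g * h - g * mfrac_deriv i h) / (h * h)"
proof -
  have "mfrac_deriv i g = mfrac_deriv i (g / h) * h + g / h * mfrac_deriv i h"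
    using mfrac_deriv_mult[of i "g / h" h] assms by simp
  then show ?thesis using assms by (simp add: field_simps)
qed

lemma mfrac_deriv_commute: "mfrac_deriv i (mfrac_deriv j g) = mfrac_deriv j (mfrac_deriv i g)"
proof -
  obtain a b where g: "g = Fract a b" "b \<noteq> 0" by (cases g)
  let ?a = "to_fract a" and ?b = "to_fract b"
  have b: "?b \<noteq> 0" using g by simp
  define B where "B q = mfrac_deriv i (mfrac_deriv j q) - mfrac_deriv j (mfrac_deriv i q)" for q
  have Bm: "B (q * r) = B q * r + q * B r" for q r
    by (simp add: B_def mfrac_deriv_mult mfrac_deriv_add algebra_simps)
  have Bp: "B (to_fract q) = 0" for q
    by (simp add: B_def mpoly_deriv_commute[of i j])
  have "g * ?b = ?a" using g by (simp add: to_fract_def eq_fract)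
  then have "B g * ?b = 0" using Bm[of g ?b] Bp by simp
  with b show ?thesis by (simp add: B_def)
qed


section \<open>The Weyl algebra over the rational functions\<close>

text \<open>
  A differential operator with rational coefficients is written uniquely as a finite sum of
  terms \<open>c \<partial>\<^sup>\<beta>\<close>; \<open>symbol\<close> gives its coefficients \<open>c\<close>. The type is a copy of the
  finitely supported maps because the multiplication is not the convolution. The subring with
  coefficients in a subring \<open>R\<close> of the rational functions is \<open>weyl_over R\<close> below.
\<close>

typedef (overloaded) 'n weyl = "UNIV :: (('n::{finite,linorder} \<Rightarrow>\<^sub>0 nat) \<Rightarrow>\<^sub>0 'n mfrac) set"
  morphisms symbol Weyl ..

setup_lifting type_definition_weyl

instantiation weyl :: ("{finite,linorder}") ab_group_add
begin
lift_definition zero_weyl :: "'a weyl" is 0 .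
lift_definition plus_weyl :: "'a weyl \<Rightarrow> 'a weyl \<Rightarrow> 'a weyl" is "(+)" .
lift_definition minus_weyl :: "'a weyl \<Rightarrow> 'a weyl \<Rightarrow> 'a weyl" is "(-)" .
lift_definition uminus_weyl :: "'a weyl \<Rightarrow> 'a weyl" is uminus .
instance by standard (transfer; simp add: algebra_simps)+
end

lemma symbol_Weyl [simp]: "symbol (Weyl p) = p" by (simp add: Weyl_inverse)
lemma symbol_0 [simp]: "symbol 0 = 0" by transfer simp
lemma symbol_add [simp]: "symbol (P + Q) = symbol P + symbol Q" by transfer simp
lemma weyl_eqI: "symbol P = symbol Q \<Longrightarrow> P = Q" by (simp add: symbol_inject)

definition wterm :: "'n::{finite,linorder} mfrac \<Rightarrow> ('n \<Rightarrow>\<^sub>0 nat) \<Rightarrow> 'n weyl" where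
  "wterm c \<beta> = Weyl (Poly_Mapping.single \<beta> c)"

text \<open>
  Left multiplication by a function and by \<open>\<partial>\<^sub>i\<close>; the latter is
  \<open>\<partial>\<^sub>i \<cdot> c \<partial>\<^sup>\<beta> = c \<partial>\<^sub>i \<partial>\<^sup>\<beta> + (\<partial>c/\<partial>x\<^sub>i) \<partial>\<^sup>\<beta>\<close>. The products on the right are convolutions of symbols.
\<close>

definition wscale :: "'n::{finite,linorder} mfrac \<Rightarrow> 'n weyl \<Rightarrow> 'n weyl" where
  "wscale c P = Weyl (Poly_Mapping.single 0 c * symbol P)"

definition wder :: "'n::{finite,linorder} \<Rightarrow> 'n weyl \<Rightarrow> 'n weyl" where
  "wder i P = Weyl (Poly_Mapping.single (Poly_Mapping.single i 1) 1 * symbol P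
     + Poly_Mapping.map (mfrac_deriv i) (symbol P))"

definition op_power :: "('n::{finite,linorder} \<Rightarrow> 'm \<Rightarrow> 'm) \<Rightarrow> ('n \<Rightarrow>\<^sub>0 nat) \<Rightarrow> 'm \<Rightarrow> 'm" where
  "op_power T \<beta> = foldr (\<lambda>i. T i ^^ Poly_Mapping.lookup \<beta> i) (sorted_list_of_set UNIV)"

text \<open>The action of an operator on a space where functions act by \<open>\<sigma>\<close> and \<open>\<partial>\<^sub>i\<close> acts by \<open>T i\<close>.\<close>

definition weyl_act ::
  "('n::{finite,linorder} mfrac \<Rightarrow> 'm \<Rightarrow> 'm) \<Rightarrow> ('n \<Rightarrow> 'm \<Rightarrow> 'm) \<Rightarrow> 'n weyl \<Rightarrow> 'm \<Rightarrow> 'm::comm_monoid_add" where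
  "weyl_act \<sigma> T P m =
     (\<Sum>\<beta>\<in>Poly_Mapping.keys (symbol P). \<sigma> (Poly_Mapping.lookup (symbol P) \<beta>) (op_power T \<beta> m))"

definition weyl_over :: "'n::{finite,linorder} mfrac set \<Rightarrow> 'n weyl set" where
  "weyl_over R = {P. \<forall>\<beta>. Poly_Mapping.lookup (symbol P) \<beta> \<in> R}"

lemma op_power_0 [simp]: "op_power T 0 m = m"
proof -
  have "foldr (\<lambda>i. T i ^^ Poly_Mapping.lookup 0 i) xs m = m" for xs by (induction xs) auto
  then show ?thesis by (simp add: op_power_def)
qed

lemma op_power_step:
  fixes T :: "'n::{finite,linorder} \<Rightarrow> 'm \<Rightarrow> 'm"
  assumes comm: "\<And>i j m. T i (T j m) = T j (T i m)"
  shows "op_power T (Poly_Mapping.single i 1 + \<beta>) m = T i (op_power T \<beta> m)"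
proof -
  have c1: "(T j ^^ k) (T i m) = T i ((T j ^^ k) m)" for j k m
    by (induction k) (auto simp: comm)
  let ?b = "Poly_Mapping.lookup \<beta>" and ?b' = "Poly_Mapping.lookup (Poly_Mapping.single i 1 + \<beta>)"
  have n: "i \<notin> set xs \<Longrightarrow> foldr (\<lambda>j. T j ^^ ?b' j) xs m = foldr (\<lambda>j. T j ^^ ?b j) xs m" for xs
    by (induction xs) (auto simp: lookup_add lookup_single when_def)
  have "distinct xs \<Longrightarrow> i \<in> set xs \<Longrightarrow>
      foldr (\<lambda>j. T j ^^ ?b' j) xs m = T i (foldr (\<lambda>j. T j ^^ ?b j) xs m)" for xs
  proof (induction xs)
    case (Cons j xs)
    show ?case
    proof (cases "i = j")
      case True
      with Cons.prems have "i \<notin> set xs" by auto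
      then show ?thesis using True n by (simp add: lookup_add)
    next
      case False
      with Cons show ?thesis by (simp add: c1 lookup_add lookup_single)
    qed
  qed simp
  then show ?thesis by (simp add: op_power_def)
qed

lemma exp_induct [case_names zero step]:
  fixes \<beta> :: "'n::finite \<Rightarrow>\<^sub>0 nat"
  assumes z: "P 0" and s: "\<And>i \<beta>. P \<beta> \<Longrightarrow> P (Poly_Mapping.single i 1 + \<beta>)"
  shows "P \<beta>"
proof (induction "\<Sum>i\<in>UNIV. Poly_Mapping.lookup \<beta> i" arbitrary: \<beta>)
  case 0
  then have "\<beta> = 0" by (intro poly_mapping_eqI) simp
  with z show ?case by simp
next
  case (Suc k)
  then obtain i where i: "Poly_Mapping.lookup \<beta> i \<noteq> 0"
    by (metis Zero_not_Suc sum.neutral)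
  let ?c = "\<beta> - Poly_Mapping.single i 1"
  have b: "\<beta> = Poly_Mapping.single i 1 + ?c"
    using i by (intro poly_mapping_eqI) (auto simp: lookup_add lookup_minus lookup_single when_def)
  have "(\<Sum>j\<in>UNIV. Poly_Mapping.lookup \<beta> j)
     = (\<Sum>j\<in>UNIV. Poly_Mapping.lookup (Poly_Mapping.single i 1) j + Poly_Mapping.lookup ?c j)"
    by (subst b) (simp add: lookup_add)
  also have "\<dots> = 1 + (\<Sum>j\<in>UNIV. Poly_Mapping.lookup ?c j)"
    by (simp add: sum.distrib lookup_single when_def)
  finally have "P ?c" using Suc by simp
  then show ?case using s[of ?c i] b by simp
qed

lemma symbol_wterm [simp]: "symbol (wterm c \<beta>) = Poly_Mapping.single \<beta> c"
  by (simp add: wterm_def)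
lemma symbol_wscale [simp]: "symbol (wscale c P) = Poly_Mapping.single 0 c * symbol P"
  by (simp add: wscale_def)
lemma symbol_wder [simp]:
  "symbol (wder i P) = Poly_Mapping.single (Poly_Mapping.single i 1) 1 * symbol P
     + Poly_Mapping.map (mfrac_deriv i) (symbol P)"
  by (simp add: wder_def)

lemma lookup_map_deriv [simp]:
  "Poly_Mapping.lookup (Poly_Mapping.map (mfrac_deriv i) p) \<beta> = mfrac_deriv i (Poly_Mapping.lookup p \<beta>)"
  by (simp add: Poly_Mapping.map.rep_eq when_def)
lemma map_deriv_add: "Poly_Mapping.map (mfrac_deriv i) (p + q)
     = Poly_Mapping.map (mfrac_deriv i) p + Poly_Mapping.map (mfrac_deriv i) q"
  by (rule poly_mapping_eqI) (simp add: lookup_add mfrac_deriv_add)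
lemma map_deriv_single: "Poly_Mapping.map (mfrac_deriv i) (Poly_Mapping.single \<beta> c)
     = Poly_Mapping.single \<beta> (mfrac_deriv i c)"
  by (rule poly_mapping_eqI) (simp add: lookup_single when_def)

lemma wterm_0 [simp]: "wterm 0 \<beta> = 0" by (rule weyl_eqI) simp
lemma wterm_add: "wterm (c + d) \<beta> = wterm c \<beta> + wterm d \<beta>" by (rule weyl_eqI) (simp add: single_add)
lemma wscale_wterm [simp]: "wscale c (wterm d \<beta>) = wterm (c * d) \<beta>"
  by (rule weyl_eqI) (simp add: mult_single)
lemma wder_wterm: "wder i (wterm c \<beta>) = wterm c (Poly_Mapping.single i 1 + \<beta>) + wterm (mfrac_deriv i c) \<beta>"
  by (rule weyl_eqI) (simp add: mult_single map_deriv_single)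

lemma wscale_add: "wscale c (P + Q) = wscale c P + wscale c Q"
  by (rule weyl_eqI) (simp add: algebra_simps)
lemma wscale_add_left: "wscale (c + d) P = wscale c P + wscale d P"
  by (rule weyl_eqI) (simp add: algebra_simps single_add)
lemma wscale_mult: "wscale (c * d) P = wscale c (wscale d P)"
  by (rule weyl_eqI) (simp add: mult_single mult.assoc[symmetric])
lemma wscale_1 [simp]: "wscale 1 P = P"
  by (rule weyl_eqI) simp
lemma wder_add: "wder i (P + Q) = wder i P + wder i Q"
  by (rule weyl_eqI) (simp add: algebra_simps map_deriv_add)

lemma weyl_sum_wterm:
  fixes P :: "'n::{finite,linorder} weyl"
  shows "(\<Sum>\<beta>\<in>Poly_Mapping.keys (symbol P). wterm (Poly_Mapping.lookup (symbol P) \<beta>) \<beta>) = P"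
proof -
  have "symbol (\<Sum>\<beta>\<in>A. wterm (c \<beta>) \<beta>) = (\<Sum>\<beta>\<in>A. Poly_Mapping.single \<beta> (c \<beta>))" for A and c :: "('n \<Rightarrow>\<^sub>0 nat) \<Rightarrow> 'n mfrac"
    by (induction A rule: infinite_finite_induct) (auto simp: symbol_add symbol_wterm)
  then show ?thesis
    by (simp add: symbol_inject[symmetric] pm_sum_single)
qed

lemma weyl_over_induct [consumes 1, case_names zero wterm add closed]:
  assumes "P \<in> weyl_over R" and z: "0 \<in> R"
    and t: "\<And>c \<beta>. c \<in> R \<Longrightarrow> Q (wterm c \<beta>)"
    and a: "\<And>P P'. P \<in> weyl_over R \<Longrightarrow> P' \<in> weyl_over R \<Longrightarrow> Q P \<Longrightarrow> Q P' \<Longrightarrow> Q (P + P')"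
    and ra: "\<And>c d. c \<in> R \<Longrightarrow> d \<in> R \<Longrightarrow> c + d \<in> R"
  shows "Q P"
proof -
  let ?c = "Poly_Mapping.lookup (symbol P)"
  have w: "wterm (?c \<beta>) \<beta> \<in> weyl_over R" for \<beta>
    using assms(1) z by (simp add: weyl_over_def symbol_wterm lookup_single when_def)
  have s: "P \<in> weyl_over R \<Longrightarrow> P' \<in> weyl_over R \<Longrightarrow> P + P' \<in> weyl_over R" for P P'
    by (simp add: weyl_over_def symbol_add lookup_add ra)
  have "finite A \<Longrightarrow> Q (\<Sum>\<beta>\<in>A. wterm (?c \<beta>) \<beta>) \<and> (\<Sum>\<beta>\<in>A. wterm (?c \<beta>) \<beta>) \<in> weyl_over R" for A
  proof (induction A rule: finite_induct)
    case empty
    show ?case using t[OF z, of 0] z by (simp add: weyl_over_def)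
  next
    case (insert \<beta> A)
    have "Q (wterm (?c \<beta>) \<beta>)" using assms(1) t by (simp add: weyl_over_def)
    then show ?case using insert a s w by simp
  qed
  from this[of "Poly_Mapping.keys (symbol P)"] show ?thesis by (simp add: weyl_sum_wterm)
qed

lemma weyl_induct [case_names wterm add]:
  assumes "\<And>c \<beta>. Q (wterm c \<beta>)" and "\<And>P P'. Q P \<Longrightarrow> Q P' \<Longrightarrow> Q (P + P')"
  shows "Q P"
proof -
  have "P \<in> weyl_over UNIV" by (simp add: weyl_over_def)
  then show ?thesis by (rule weyl_over_induct) (simp_all add: assms)
qed

lemma wder_wscale: "wder i (wscale c P) = wscale c (wder i P) + wscale (mfrac_deriv i c) P"
  by (induction P rule: weyl_induct)
     (simp_all add: wder_wterm wder_add wscale_add mfrac_deriv_mult wterm_add algebra_simps)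

lemma wder_commute: "wder i (wder j P) = wder j (wder i P)"
  by (induction P rule: weyl_induct)
     (simp_all add: wder_wterm wder_add mfrac_deriv_commute[of i j] algebra_simps)

locale coeff_ring =
  fixes R :: "'n::{finite,linorder} mfrac set"
  assumes R_0: "0 \<in> R" and R_1: "1 \<in> R"
    and R_uminus: "\<And>c. c \<in> R \<Longrightarrow> - c \<in> R"
    and R_add: "\<And>c d. c \<in> R \<Longrightarrow> d \<in> R \<Longrightarrow> c + d \<in> R"
    and R_mult: "\<And>c d. c \<in> R \<Longrightarrow> d \<in> R \<Longrightarrow> c * d \<in> R"
    and R_deriv: "\<And>c i. c \<in> R \<Longrightarrow> mfrac_deriv i c \<in> R"

locale weyl_rep = coeff_ring R for R :: "'n::{finite,linorder} mfrac set" +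
  fixes \<sigma> :: "'n mfrac \<Rightarrow> 'm \<Rightarrow> 'm::ab_group_add" and T :: "'n \<Rightarrow> 'm \<Rightarrow> 'm"
  assumes s_1: "\<And>m. \<sigma> 1 m = m"
    and s_add: "\<And>c m m'. c \<in> R \<Longrightarrow> \<sigma> c (m + m') = \<sigma> c m + \<sigma> c m'"
    and s_add_left: "\<And>c d m. c \<in> R \<Longrightarrow> d \<in> R \<Longrightarrow> \<sigma> (c + d) m = \<sigma> c m + \<sigma> d m"
    and s_mult: "\<And>c d m. c \<in> R \<Longrightarrow> d \<in> R \<Longrightarrow> \<sigma> (c * d) m = \<sigma> c (\<sigma> d m)"
    and T_add: "\<And>i m m'. T i (m + m') = T i m + T i m'"
    and T_s: "\<And>i c m. c \<in> R \<Longrightarrow> T i (\<sigma> c m) = \<sigma> c (T i m) + \<sigma> (mfrac_deriv i c) m"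
    and T_commute: "\<And>i j m. T i (T j m) = T j (T i m)"
begin

abbreviation "act \<equiv> weyl_act \<sigma> T"

lemma s_0: "\<sigma> 0 m = 0"
  using s_add_left[OF R_0 R_0, of m] by simp

lemma s_0_right: "c \<in> R \<Longrightarrow> \<sigma> c 0 = 0"
  using s_add[of c 0 0] by simp

lemma T_0: "T i 0 = 0"
  using T_add[of i 0 0] by simp

lemma op_power_add: "op_power T \<beta> (m + m') = op_power T \<beta> m + op_power T \<beta> m'"
  by (induction \<beta> rule: exp_induct) (simp_all add: op_power_step[of T, OF T_commute] T_add del: One_nat_def)

lemma act_wterm: "act (wterm c \<beta>) m = \<sigma> c (op_power T \<beta> m)"
  unfolding weyl_act_def symbol_wterm by (rule pm_sum_on_single) (rule s_0)

lemma act_add_left: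
  "P \<in> weyl_over R \<Longrightarrow> Q \<in> weyl_over R \<Longrightarrow> act (P + Q) m = act P m + act Q m"
  unfolding weyl_act_def symbol_add
  by (rule pm_sum_add) (auto simp: s_0 weyl_over_def s_add_left)

lemma act_0_left: "act 0 m = 0"
  by (simp add: weyl_act_def)

lemma act_add_right: "P \<in> weyl_over R \<Longrightarrow> act P (m + m') = act P m + act P m'"
  by (simp add: weyl_act_def op_power_add weyl_over_def s_add sum.distrib)

lemma act_1: "act (wterm 1 0) m = m"
  by (simp add: act_wterm s_1)

lemma weyl_over_add: "P \<in> weyl_over R \<Longrightarrow> Q \<in> weyl_over R \<Longrightarrow> P + Q \<in> weyl_over R"
  by (simp add: weyl_over_def symbol_add lookup_add R_add)

lemma weyl_over_0: "0 \<in> weyl_over R"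
  by (simp add: weyl_over_def R_0)

lemma weyl_over_wterm: "c \<in> R \<Longrightarrow> wterm c \<beta> \<in> weyl_over R"
  by (simp add: weyl_over_def symbol_wterm lookup_single when_def R_0)

lemma induct_R:
  assumes "P \<in> weyl_over R" "\<And>c \<beta>. c \<in> R \<Longrightarrow> Q (wterm c \<beta>)"
    "\<And>P P'. P \<in> weyl_over R \<Longrightarrow> P' \<in> weyl_over R \<Longrightarrow> Q P \<Longrightarrow> Q P' \<Longrightarrow> Q (P + P')"
  shows "Q P"
  using assms(1) R_0 assms(2) assms(3) R_add by (rule weyl_over_induct)

lemma wscale_closed: "c \<in> R \<Longrightarrow> P \<in> weyl_over R \<Longrightarrow> wscale c P \<in> weyl_over R"
  by (erule induct_R) (auto simp: wscale_add intro: weyl_over_add weyl_over_wterm R_mult)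

lemma wder_closed: "P \<in> weyl_over R \<Longrightarrow> wder i P \<in> weyl_over R"
  by (erule induct_R) (auto simp: wder_add wder_wterm intro!: weyl_over_add weyl_over_wterm R_deriv)

lemma op_power_wder_closed: "P \<in> weyl_over R \<Longrightarrow> op_power wder \<beta> P \<in> weyl_over R"
  by (induction \<beta> rule: exp_induct)
     (simp_all add: op_power_step[of wder, OF wder_commute] wder_closed del: One_nat_def)

lemma act_wscale: "c \<in> R \<Longrightarrow> P \<in> weyl_over R \<Longrightarrow> act (wscale c P) m = \<sigma> c (act P m)"
  by (erule induct_R)
     (simp_all add: act_wterm s_mult wscale_add act_add_left wscale_closed s_add)

lemma act_wder: "P \<in> weyl_over R \<Longrightarrow> act (wder i P) m = T i (act P m)"
  by (erule induct_R)
     (simp_all add: act_wterm T_s wder_wterm wder_add act_add_left wder_closed T_add weyl_over_wterm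
        R_deriv op_power_step[of T, OF T_commute] del: One_nat_def)

lemma act_op_power: "P \<in> weyl_over R \<Longrightarrow> act (op_power wder \<beta> P) m = op_power T \<beta> (act P m)"
  by (induction \<beta> rule: exp_induct)
     (simp_all add: op_power_step[of wder, OF wder_commute] op_power_step[of T, OF T_commute] act_wder
        op_power_wder_closed del: One_nat_def)

lemma weyl_act_closed_and_act:
  assumes P: "P \<in> weyl_over R" and Q: "Q \<in> weyl_over R"
  shows "weyl_act wscale wder P Q \<in> weyl_over R \<and> act (weyl_act wscale wder P Q) m = act P (act Q m)"
proof -
  let ?c = "Poly_Mapping.lookup (symbol P)"
  have c: "?c \<beta> \<in> R" for \<beta> using P by (simp add: weyl_over_def)
  have "finite A \<Longrightarrow> (\<Sum>\<beta>\<in>A. wscale (?c \<beta>) (op_power wder \<beta> Q)) \<in> weyl_over R \<and>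
     act (\<Sum>\<beta>\<in>A. wscale (?c \<beta>) (op_power wder \<beta> Q)) m = (\<Sum>\<beta>\<in>A. \<sigma> (?c \<beta>) (op_power T \<beta> (act Q m)))" for A
    by (induction A rule: finite_induct)
       (auto simp: weyl_over_0 act_0_left act_add_left weyl_over_add wscale_closed c
         op_power_wder_closed Q act_wscale act_op_power)
  from this[of "Poly_Mapping.keys (symbol P)"] show ?thesis by (simp add: weyl_act_def)
qed

end

interpretation weyl_self: weyl_rep UNIV wscale wder
  by standard (simp_all add: wscale_add wscale_add_left wscale_mult wder_add wder_wscale wder_commute)

lemma weyl_over_UNIV [simp]: "weyl_over UNIV = UNIV"
  by (simp add: weyl_over_def)

lemma op_power_wder_1: "op_power wder \<beta> (wterm 1 0) = wterm 1 \<beta>"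
  by (induction \<beta> rule: exp_induct)
     (simp_all add: op_power_step[of wder, OF wder_commute] wder_wterm del: One_nat_def)

instantiation weyl :: ("{finite,linorder}") ring_1
begin
definition times_weyl :: "'a weyl \<Rightarrow> 'a weyl \<Rightarrow> 'a weyl" where
  "P * Q = weyl_act wscale wder P Q"
definition one_weyl :: "'a weyl" where "1 = wterm 1 0"
instance
proof
  fix P Q S :: "'a weyl"
  show "P * Q * S = P * (Q * S)"
    using weyl_self.weyl_act_closed_and_act[of P Q S] by (simp add: times_weyl_def)
  show "1 * P = P" by (simp add: times_weyl_def one_weyl_def weyl_self.act_1)
  show "P * 1 = P"
    by (simp add: times_weyl_def one_weyl_def weyl_act_def op_power_wder_1 weyl_sum_wterm)
  show "(P + Q) * S = P * S + Q * S" by (simp add: times_weyl_def weyl_self.act_add_left)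
  show "P * (Q + S) = P * Q + P * S" by (simp add: times_weyl_def weyl_self.act_add_right)
  show "(0 :: 'a weyl) \<noteq> 1" by (auto simp: one_weyl_def dest!: arg_cong[of _ _ "\<lambda>P. Poly_Mapping.lookup (symbol P) 0"])
qed
end

lemma (in weyl_rep) act_mult:
  "P \<in> weyl_over R \<Longrightarrow> Q \<in> weyl_over R \<Longrightarrow> act (P * Q) m = act P (act Q m)"
  using weyl_act_closed_and_act by (simp add: times_weyl_def)

lemma (in weyl_rep) weyl_over_mult:
  "P \<in> weyl_over R \<Longrightarrow> Q \<in> weyl_over R \<Longrightarrow> P * Q \<in> weyl_over R"
  using weyl_act_closed_and_act by (simp add: times_weyl_def)


definition wfun :: "'n::{finite,linorder} mfrac \<Rightarrow> 'n weyl" where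
  "wfun c = wterm c 0"

definition wpartial :: "'n::{finite,linorder} \<Rightarrow> 'n weyl" where
  "wpartial i = wterm 1 (Poly_Mapping.single i 1)"

lemma wterm_mult: "wterm c \<beta> * P = wscale c (op_power wder \<beta> P)"
  by (simp add: times_weyl_def weyl_self.act_wterm)

lemma wfun_mult: "wfun c * P = wscale c P"
  by (simp add: wfun_def wterm_mult)

lemma wpartial_mult: "wpartial i * P = wder i P"
  using op_power_step[of wder, OF wder_commute, of i 0 P]
  by (simp add: wpartial_def wterm_mult del: One_nat_def)

lemma wfun_add: "wfun (c + d) = wfun c + wfun d"
  by (simp add: wfun_def wterm_add)

lemma wfun_times: "wfun (c * d) = wfun c * wfun d"
  unfolding wfun_mult by (simp add: wfun_def)

lemma wfun_1: "wfun 1 = 1"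
  by (simp add: wfun_def one_weyl_def)

lemma wpartial_commute: "wpartial i * wpartial j = wpartial j * wpartial i"
  unfolding wpartial_mult unfolding wpartial_def wder_wterm by (simp add: add.commute)

lemma wpartial_wfun: "wpartial i * wfun c = wfun c * wpartial i + wfun (mfrac_deriv i c)"
  unfolding wpartial_mult wfun_mult unfolding wfun_def wpartial_def wder_wterm by simp

lemma wterm_eq: "wterm c (Poly_Mapping.single i 1 + \<beta>) = wfun c * (wpartial i * wterm 1 \<beta>)"
  unfolding wpartial_mult wfun_mult by (simp add: wder_wterm del: One_nat_def)


subsection \<open>Polynomial coefficients: the Weyl algebra by generators and relations\<close>

definition polynomials :: "'n::{finite,linorder} mfrac set" where
  "polynomials = range to_fract"

text \<open>
  The elements \<open>wfun (to_fract (Const c))\<close>, \<open>wfun (to_fract (Var i))\<close> and \<open>wpartial i\<close> generate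
  \<open>weyl_over polynomials\<close> (\<open>weyl_generated\<close>), and they satisfy the defining relations of the
  Weyl algebra (\<open>weyl_relations\<close>) and no others (\<open>weyl_universal\<close>).
\<close>

lemma coeff_ring_polynomials: "coeff_ring (polynomials :: 'n::{finite,linorder} mfrac set)"
proof
  show "0 \<in> polynomials" "1 \<in> polynomials"
    by (auto simp: polynomials_def intro: range_eqI[of _ _ 0] range_eqI[of _ _ 1])
next
  fix c d :: "'n mfrac" and i assume "c \<in> polynomials"
  then obtain a where c: "c = to_fract a" by (auto simp: polynomials_def)
  show "- c \<in> polynomials" using c by (auto simp: polynomials_def intro: range_eqI[of _ _ "- a"])
  show "mfrac_deriv i c \<in> polynomials" using c by (simp add: polynomials_def)
  assume "d \<in> polynomials"
  then obtain b where d: "d = to_fract b" by (auto simp: polynomials_def)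
  show "c + d \<in> polynomials"
    using c d by (auto simp: polynomials_def intro: range_eqI[of _ _ "a + b"])
  show "c * d \<in> polynomials"
    using c d by (auto simp: polynomials_def intro: range_eqI[of _ _ "a * b"])
qed

lemma weyl_relations:
  defines "x \<equiv> \<lambda>i. wfun (to_fract (Var i))"
  shows "wpartial i * x j = x j * wpartial i + (if i = j then 1 else 0)"
    and "x i * x j = x j * x i"
    and "wpartial i * wpartial j = wpartial j * wpartial i"
    and "wfun (to_fract (Const c)) * x i = x i * wfun (to_fract (Const c))"
    and "wfun (to_fract (Const c)) * wpartial i = wpartial i * wfun (to_fract (Const c))"
proof -
  have 0: "wfun 0 = 0" by (simp add: wfun_def)
  show "wpartial i * x j = x j * wpartial i + (if i = j then 1 else 0)"
    by (simp add: x_def wpartial_wfun mpoly_deriv_Var wfun_1 0)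
  show "wpartial i * wpartial j = wpartial j * wpartial i" by (rule wpartial_commute)
  show "x i * x j = x j * x i" "wfun (to_fract (Const c)) * x i = x i * wfun (to_fract (Const c))"
    by (simp_all add: x_def wfun_times[symmetric] mult.commute)
  show "wfun (to_fract (Const c)) * wpartial i = wpartial i * wfun (to_fract (Const c))"
    by (simp add: wpartial_wfun 0)
qed

lemma mpoly_induct [case_names Const Var add]:
  fixes g :: "'n::finite mpoly"
  assumes C: "\<And>c. P (Const c)" and V: "\<And>i g. P g \<Longrightarrow> P (Var i * g)"
    and a: "\<And>g h. P g \<Longrightarrow> P h \<Longrightarrow> P (g + h)"
  shows "P g"
proof (induction g rule: pm_induct)
  case (single m c)
  show ?case
  proof (induction m rule: exp_induct)
    case zero
    show ?case using C[of c] by (simp add: Const_def)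
  next
    case (step i \<beta>)
    then show ?case using V[OF step, of i] by (simp add: Var_def mult_single)
  qed
qed (rule a)

lemma weyl_generated:
  fixes S :: "'n::{finite,linorder} weyl set"
  assumes C: "\<And>c. wfun (to_fract (Const c)) \<in> S" and X: "\<And>i. wfun (to_fract (Var i)) \<in> S"
    and D: "\<And>i. wpartial i \<in> S"
    and add: "\<And>P Q. P \<in> S \<Longrightarrow> Q \<in> S \<Longrightarrow> P + Q \<in> S"
    and mult: "\<And>P Q. P \<in> S \<Longrightarrow> Q \<in> S \<Longrightarrow> P * Q \<in> S"
  shows "weyl_over polynomials \<subseteq> S"
proof
  interpret coeff_ring "polynomials :: 'n mfrac set" by (rule coeff_ring_polynomials)
  fix P :: "'n weyl" assume "P \<in> weyl_over polynomials"
  then show "P \<in> S"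
  proof (induction P rule: weyl_over_induct)
    case (wterm c \<beta>)
    then obtain g where c: "c = to_fract g" by (auto simp: polynomials_def)
    have f: "wfun (to_fract g) \<in> S" for g
      by (induction g rule: mpoly_induct) (auto simp: wfun_times wfun_add intro: C X add mult)
    have "wterm 1 \<beta> \<in> S"
    proof (induction \<beta> rule: exp_induct)
      case zero
      show ?case using f[of 1] by (simp add: wfun_def)
    next
      case (step i \<beta>)
      then show ?case unfolding wterm_eq wfun_1 using D mult by simp
    qed
    then have "wfun c * wterm 1 \<beta> \<in> S" using f mult c by blast
    then show ?case by (simp add: wfun_mult)
  qed (auto intro: R_0 R_add add)
qed

lemma weyl_universal:
  fixes h :: "complex \<Rightarrow> 'a::ring_1" and X Y :: "'n::{finite,linorder} \<Rightarrow> 'a"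
  assumes h1: "h 1 = 1" and h_add: "\<And>c d. h (c + d) = h c + h d" and h_mult: "\<And>c d. h (c * d) = h c * h d"
    and h_central: "\<And>c a. h c * a = a * h c"
    and XX: "\<And>i j. X i * X j = X j * X i" and YY: "\<And>i j. Y i * Y j = Y j * Y i"
    and YX: "\<And>i j. Y i * X j = X j * Y i + (if i = j then 1 else 0)"
  obtains \<phi> :: "'n weyl \<Rightarrow> 'a" where
    "\<phi> 1 = 1"
    "\<And>P Q. P \<in> weyl_over polynomials \<Longrightarrow> Q \<in> weyl_over polynomials \<Longrightarrow> \<phi> (P + Q) = \<phi> P + \<phi> Q"
    "\<And>P Q. P \<in> weyl_over polynomials \<Longrightarrow> Q \<in> weyl_over polynomials \<Longrightarrow> \<phi> (P * Q) = \<phi> P * \<phi> Q"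
    "\<And>c. \<phi> (wfun (to_fract (Const c))) = h c"
    "\<And>i. \<phi> (wfun (to_fract (Var i))) = X i"
    "\<And>i. \<phi> (wpartial i) = Y i"
proof -
  have h0: "h 0 = 0" using h_add[of 0 0] by simp
  have Xc: "X i * (X j * m) = X j * (X i * m)" for i j m by (simp add: mult.assoc[symmetric] XX)
  define ev where "ev g = (\<Sum>m\<in>Poly_Mapping.keys g. h (Poly_Mapping.lookup g m) * op_power (\<lambda>i. (*) (X i)) m 1)" for g
  have ev_add: "ev (g + g') = ev g + ev g'" for g g'
    unfolding ev_def by (rule pm_sum_add) (auto simp: h0 h_add algebra_simps)
  have ev_single: "ev (Poly_Mapping.single m c) = h c * op_power (\<lambda>i. (*) (X i)) m 1" for m c
    unfolding ev_def by (rule pm_sum_on_single) (simp add: h0)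
  have ev_C: "ev (Const c) = h c" for c by (simp add: Const_def ev_single)
  have ev_0: "ev 0 = 0" by (simp add: ev_def)
  have ev_1: "ev 1 = 1" using ev_C[of 1] by (simp add: Const_def h1)
  have ev_Cm: "ev (Const c * g) = h c * ev g" for c g
    by (induction g rule: pm_induct)
       (simp_all add: Const_def mult_single ev_single h_mult mult.assoc ev_add distrib_left)
  have ev_V: "ev (Var i * g) = X i * ev g" for i g
  proof (induction g rule: pm_induct)
    case (single m c)
    have "ev (Var i * Poly_Mapping.single m c) = h c * (X i * op_power (\<lambda>i. (*) (X i)) m 1)"
      using op_power_step[of "\<lambda>i. (*) (X i)", OF Xc, of i m 1]
      by (simp add: Var_def mult_single ev_single)
    then show ?case by (metis ev_single h_central mult.assoc)
  qed (simp add: ev_add distrib_left)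
  have ev_mult: "ev (g * g') = ev g * ev g'" for g g'
    by (induction g rule: mpoly_induct) (simp_all add: ev_Cm ev_C ev_V ev_add mult.assoc distrib_right)
  have ev_Var: "ev (Var i) = X i" for i using ev_V[of i 1] by (simp add: ev_1)
  have Yev: "Y i * ev g = ev g * Y i + ev (mpoly_deriv i g)" for i g
  proof (induction g rule: mpoly_induct)
    case (Const c)
    show ?case using h_central[of c "Y i"] unfolding ev_C mpoly_deriv_Const by (simp add: ev_0)
  next
    case (Var j g)
    have "Y i * ev (Var j * g) = (Y i * X j) * ev g" by (simp add: ev_V mult.assoc)
    also have "\<dots> = X j * (Y i * ev g) + (if i = j then 1 else 0) * ev g"
      unfolding YX by (simp add: distrib_right mult.assoc)
    also have "\<dots> = ev (Var j * g) * Y i + ev (mpoly_deriv i (Var j * g))"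
      unfolding Var
      by (auto simp: ev_V ev_0 mpoly_deriv_mult mpoly_deriv_Var ev_add distrib_left distrib_right mult.assoc)
    finally show ?case .
  next
    case (add g g')
    then show ?case by (simp add: ev_add mpoly_deriv_add algebra_simps)
  qed
  define \<sigma> where "\<sigma> c m = ev (inv to_fract c) * m" for c :: "'n mfrac" and m :: 'a
  have inj: "inj (to_fract :: 'n mpoly \<Rightarrow> _)" by (auto intro: injI)
  have \<sigma>: "\<sigma> (to_fract g) m = ev g * m" for g m by (simp add: \<sigma>_def inv_f_f[OF inj])
  interpret coeff_ring "polynomials :: 'n mfrac set" by (rule coeff_ring_polynomials)
  interpret W: weyl_rep polynomials \<sigma> "\<lambda>i. (*) (Y i)"
  proof
    fix i j :: 'n and m m' :: 'a
    show "\<sigma> 1 m = m" using \<sigma>[of 1 m] by (simp add: ev_1)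
    show "Y i * (m + m') = Y i * m + Y i * m'" by (rule distrib_left)
    show "Y i * (Y j * m) = Y j * (Y i * m)" by (simp add: mult.assoc[symmetric] YY)
  next
    fix c and m m' :: 'a and i assume "c \<in> (polynomials :: 'n mfrac set)"
    then obtain g where c: "c = to_fract g" by (auto simp: polynomials_def)
    show "\<sigma> c (m + m') = \<sigma> c m + \<sigma> c m'" by (simp add: \<sigma>_def distrib_left)
    show "Y i * \<sigma> c m = \<sigma> c (Y i * m) + \<sigma> (mfrac_deriv i c) m"
      by (simp add: c \<sigma> Yev mult.assoc[symmetric] distrib_right)
    fix d assume "d \<in> (polynomials :: 'n mfrac set)"
    then obtain k where d: "d = to_fract k" by (auto simp: polynomials_def)
    show "\<sigma> (c + d) m = \<sigma> c m + \<sigma> d m"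
      using \<sigma>[of "g + k" m] by (simp add: c d \<sigma> ev_add distrib_right)
    show "\<sigma> (c * d) m = \<sigma> c (\<sigma> d m)"
      using \<sigma>[of "g * k" m] by (simp add: c d \<sigma> ev_mult mult.assoc)
  qed
  define \<phi> where "\<phi> P = W.act P 1" for P
  have act_r: "W.act P (m * m') = W.act P m * m'" for P m m'
  proof -
    have "op_power (\<lambda>i. (*) (Y i)) \<beta> (m * m') = op_power (\<lambda>i. (*) (Y i)) \<beta> m * m'" for \<beta>
      by (induction \<beta> rule: exp_induct)
         (simp_all add: op_power_step[of "\<lambda>i. (*) (Y i)", OF W.T_commute] mult.assoc del: One_nat_def)
    then show ?thesis by (simp add: weyl_act_def \<sigma>_def mult.assoc sum_distrib_right)
  qed
  show ?thesis
  proof (rule that[of \<phi>])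
    show "\<phi> 1 = 1" by (simp add: \<phi>_def one_weyl_def W.act_1)
    show "\<phi> (wfun (to_fract (Const c))) = h c" for c
      by (simp add: \<phi>_def wfun_def W.act_wterm \<sigma> ev_C)
    show "\<phi> (wfun (to_fract (Var i))) = X i" for i
      by (simp add: \<phi>_def wfun_def W.act_wterm \<sigma> ev_Var)
    show "\<phi> (wpartial i) = Y i" for i
      using op_power_step[of "\<lambda>i. (*) (Y i)", OF W.T_commute, of i 0 1]
      by (simp add: \<phi>_def wpartial_def W.act_wterm W.s_1)
    fix P Q :: "'n weyl" assume PQ: "P \<in> weyl_over polynomials" "Q \<in> weyl_over polynomials"
    show "\<phi> (P + Q) = \<phi> P + \<phi> Q" using PQ by (simp add: \<phi>_def W.act_add_left)
    show "\<phi> (P * Q) = \<phi> P * \<phi> Q"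
      using PQ act_r[of P 1 "W.act Q 1"] by (simp add: \<phi>_def W.act_mult)
  qed
qed


subsection \<open>Coefficients regular at a point\<close>

text \<open>The localization at the maximal ideal of \<open>p\<close>, inside the field of fractions.\<close>

definition local_ring :: "complex ^ 'n::{finite,linorder} \<Rightarrow> 'n mfrac set" where
  "local_ring p = {Fract a b | a b. mpoly_eval p b \<noteq> 0}"

lemma mpoly_eval_add: "mpoly_eval p (g + h) = mpoly_eval p g + mpoly_eval p h"
  unfolding mpoly_eval_def by (rule pm_sum_add) (auto simp: algebra_simps)

lemma mpoly_eval_single:
  "mpoly_eval p (Poly_Mapping.single m c) = c * (\<Prod>i\<in>UNIV. (p $ i) ^ Poly_Mapping.lookup m i)"
  unfolding mpoly_eval_def by (rule pm_sum_on_single) simp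

lemma mpoly_eval_mult: "mpoly_eval p (g * h) = mpoly_eval p g * mpoly_eval p h"
proof (induction g rule: pm_induct)
  case (single m c)
  show ?case
    by (induction h rule: pm_induct)
       (simp_all add: mult_single mpoly_eval_single lookup_add power_add prod.distrib
          mpoly_eval_add distrib_left)
qed (simp add: mpoly_eval_add distrib_right)

lemma mpoly_eval_0 [simp]: "mpoly_eval p 0 = 0"
  by (simp add: mpoly_eval_def)

lemma mpoly_eval_1 [simp]: "mpoly_eval p 1 = 1"
  using mpoly_eval_single[of p 0 1] by simp

lemma coeff_ring_local_ring: "coeff_ring (local_ring p)"
proof
  show "0 \<in> local_ring p" "1 \<in> local_ring p"
    unfolding local_ring_def Zero_fract_def One_fract_def using mpoly_eval_1[of p] by fastforce+
next
  fix c d i assume "c \<in> local_ring p"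
  then obtain a b where c: "c = Fract a b" "mpoly_eval p b \<noteq> 0" by (auto simp: local_ring_def)
  then have b: "b \<noteq> 0" by auto
  show "- c \<in> local_ring p" using c by (auto simp: local_ring_def)
  show "mfrac_deriv i c \<in> local_ring p"
    unfolding local_ring_def c(1) mfrac_deriv_Fract[OF b] using c(2) mpoly_eval_mult[of p b b] by force
  assume "d \<in> local_ring p"
  then obtain a' b' where d: "d = Fract a' b'" "mpoly_eval p b' \<noteq> 0" by (auto simp: local_ring_def)
  then have b': "b' \<noteq> 0" by auto
  show "c + d \<in> local_ring p" "c * d \<in> local_ring p"
    unfolding local_ring_def c(1) d(1) add_fract[OF b b'] mult_fract
    using c(2) d(2) mpoly_eval_mult[of p b b'] by force+
qed


section \<open>The central variable \<open>s\<close> and the module generated by \<open>f\<^sup>s\<close>\<close>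

text \<open>Maps \<open>k \<mapsto> P\<^sub>k\<close> with the convolution product are the polynomials \<open>\<Sum>\<^sub>k P\<^sub>k s\<^sup>k\<close> in a central variable.\<close>

type_synonym 'n weyl_s = "nat \<Rightarrow>\<^sub>0 'n weyl"

definition weyl_s_over :: "'n::{finite,linorder} mfrac set \<Rightarrow> 'n weyl_s set" where
  "weyl_s_over R = {P. \<forall>k. Poly_Mapping.lookup P k \<in> weyl_over R}"

definition s_var :: "'n::{finite,linorder} weyl_s" where
  "s_var = Poly_Mapping.single 1 1"

definition of_mpoly :: "'n::{finite,linorder} mpoly \<Rightarrow> 'n weyl_s" where
  "of_mpoly g = Poly_Mapping.single 0 (wfun (to_fract g))"

lemma s_var_central: "s_var * P = P * s_var"
  by (induction P rule: pm_induct) (simp_all add: s_var_def mult_single algebra_simps)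

text \<open>
  An element \<open>g \<cdot> f\<^sup>s\<close> is represented by its coordinate \<open>g\<close>, a polynomial in \<open>s\<close> over the rational
  functions. For a coefficient ring \<open>R\<close> containing \<open>f\<close>, the coordinates in \<open>R[s,1/f]\<close> form a
  submodule over \<open>weyl_s_over R\<close> (\<open>fs_module_closed\<close>); it contains \<open>f\<^sup>s\<close> itself, whose coordinate
  is \<open>1\<close>.
\<close>

definition fs_deriv :: "'n::{finite,linorder} mfrac \<Rightarrow> 'n \<Rightarrow> 'n mfrac poly \<Rightarrow> 'n mfrac poly" where
  "fs_deriv f i g = map_poly (mfrac_deriv i) g + [:0, 1:] * g * [:mfrac_deriv i f * (1 / f):]"

definition fs_act :: "'n::{finite,linorder} mpoly \<Rightarrow> 'n weyl_s \<Rightarrow> 'n mfrac poly \<Rightarrow> 'n mfrac poly" where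
  "fs_act f P g = (\<Sum>k\<in>Poly_Mapping.keys P.
     [:0, 1:] ^ k * weyl_act smult (fs_deriv (to_fract f)) (Poly_Mapping.lookup P k) g)"

definition fs_module :: "'n::{finite,linorder} mfrac set \<Rightarrow> 'n mpoly \<Rightarrow> 'n mfrac poly set" where
  "fs_module R f = {g. \<forall>k. \<exists>c\<in>R. \<exists>l. coeff g k = c / to_fract f ^ l}"

lemma coeff_map_deriv [simp]: "coeff (map_poly (mfrac_deriv i) g) k = mfrac_deriv i (coeff g k)"
  by (simp add: coeff_map_poly)

lemma map_poly_deriv_add:
  "map_poly (mfrac_deriv i) (g + h) = map_poly (mfrac_deriv i) g + map_poly (mfrac_deriv i) h"
  by (rule poly_eqI) (simp add: mfrac_deriv_add)

lemma map_poly_deriv_smult: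
  "map_poly (mfrac_deriv i) (smult c g) = smult c (map_poly (mfrac_deriv i) g) + smult (mfrac_deriv i c) g"
  by (rule poly_eqI) (simp add: mfrac_deriv_mult add.commute)

lemma map_poly_deriv_pCons:
  "map_poly (mfrac_deriv i) (pCons c g) = pCons (mfrac_deriv i c) (map_poly (mfrac_deriv i) g)"
  by (rule poly_eqI) (simp add: coeff_pCons split: nat.split)

lemma fs_deriv_alt: "fs_deriv f i g = map_poly (mfrac_deriv i) g + smult (mfrac_deriv i f / f) (pCons 0 g)"
  by (simp add: fs_deriv_def)

lemma fs_deriv_commute: "fs_deriv f i (fs_deriv f j g) = fs_deriv f j (fs_deriv f i g)"
proof -
  have l: "mfrac_deriv i (mfrac_deriv j f / f) = mfrac_deriv j (mfrac_deriv i f / f)"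
    by (cases "f = 0") (simp_all add: mfrac_deriv_divide mfrac_deriv_commute[of i j] mult.commute)
  have m: "map_poly (mfrac_deriv i) (map_poly (mfrac_deriv j) g)
      = map_poly (mfrac_deriv j) (map_poly (mfrac_deriv i) g)"
    by (rule poly_eqI) (simp add: mfrac_deriv_commute[of i j])
  have p: "pCons 0 (smult c h) = smult c (pCons 0 h)" "pCons 0 (h + h') = pCons 0 h + pCons 0 h'"
    for c :: "'a mfrac" and h h' by simp_all
  show ?thesis
    unfolding fs_deriv_alt map_poly_deriv_add map_poly_deriv_smult map_poly_deriv_pCons l m p
      mfrac_deriv_0 smult_add_right smult_smult
    by (simp add: algebra_simps)
qed

interpretation fs: weyl_rep UNIV smult "fs_deriv f" for f
proof
  fix i c m m'
  show "fs_deriv f i (m + m') = fs_deriv f i m + fs_deriv f i m'"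
    by (simp add: fs_deriv_def map_poly_deriv_add smult_add_right algebra_simps)
  show "fs_deriv f i (smult c m) = smult c (fs_deriv f i m) + smult (mfrac_deriv i c) m"
    by (simp add: fs_deriv_alt map_poly_deriv_smult smult_add_right mult.commute)
qed (simp_all add: smult_add_right smult_add_left fs_deriv_commute)

lemma fs_act_single: "fs_act f (Poly_Mapping.single k P) g
    = [:0, 1:] ^ k * weyl_act smult (fs_deriv (to_fract f)) P g"
  unfolding fs_act_def by (rule pm_sum_on_single) (simp add: fs.act_0_left)

lemma fs_act_add_left: "fs_act f (P + Q) g = fs_act f P g + fs_act f Q g"
  unfolding fs_act_def
  by (rule pm_sum_add) (simp_all add: fs.act_0_left fs.act_add_left distrib_left)

lemma fs_act_add_right: "fs_act f P (g + h) = fs_act f P g + fs_act f P h"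
  by (simp add: fs_act_def fs.act_add_right distrib_left sum.distrib)

lemma weyl_act_fs_s: "weyl_act smult (fs_deriv f) P ([:0, 1:] ^ k * g)
    = [:0, 1:] ^ k * weyl_act smult (fs_deriv f) P g"
proof -
  have d: "fs_deriv f i ([:0, 1:] * g) = [:0, 1:] * fs_deriv f i g" for i g
    by (simp add: fs_deriv_alt map_poly_deriv_pCons)
  have p: "op_power (fs_deriv f) \<beta> ([:0, 1:] * g) = [:0, 1:] * op_power (fs_deriv f) \<beta> g" for \<beta> g
    by (induction \<beta> rule: exp_induct)
       (simp_all only: op_power_step[of "fs_deriv f", OF fs_deriv_commute] d op_power_0)
  have "weyl_act smult (fs_deriv f) P ([:0, 1:] * g) = [:0, 1:] * weyl_act smult (fs_deriv f) P g" for g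
    unfolding weyl_act_def p sum_distrib_left by (simp only: mult_smult_right)
  then show ?thesis by (induction k) (simp_all only: power_0 power_Suc mult_1_left mult.assoc)
qed

lemma fs_act_mult: "fs_act f (P * Q) g = fs_act f P (fs_act f Q g)"
proof (induction P rule: pm_induct)
  case (single k P)
  show ?case
    by (induction Q rule: pm_induct)
       (simp_all only: mult_single fs_act_single weyl_act_fs_s fs.act_mult weyl_over_UNIV UNIV_I
          power_add mult.assoc distrib_left fs_act_add_left fs_act_add_right)
qed (simp add: distrib_right fs_act_add_left)

lemma fs_module_closed:
  assumes "coeff_ring R" "to_fract f \<in> R" "f \<noteq> 0" "P \<in> weyl_s_over R" "g \<in> fs_module R f"
  shows "fs_act f P g \<in> fs_module R f"
proof -
  interpret coeff_ring R by fact
  let ?f = "to_fract f" and ?M = "fs_module R f"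
  have f: "?f \<noteq> 0" using assms by simp
  have pw: "?f ^ l \<in> R" for l by (induction l) (auto intro: R_1 R_mult assms)
  have M0: "0 \<in> ?M" using R_0 by (auto simp: fs_module_def)
  have Ma: "g + h \<in> ?M" if gh: "g \<in> ?M" "h \<in> ?M" for g h
    unfolding fs_module_def mem_Collect_eq
  proof
    fix k
    obtain c l d l' where "c \<in> R" "d \<in> R" and e: "coeff g k = c / ?f ^ l" "coeff h k = d / ?f ^ l'"
      using gh unfolding fs_module_def by blast
    then have "c * ?f ^ l' + d * ?f ^ l \<in> R" by (intro R_add R_mult pw)
    moreover have "coeff (g + h) k = (c * ?f ^ l' + d * ?f ^ l) / ?f ^ (l + l')"
      using f by (simp add: e field_simps power_add)
    ultimately show "\<exists>c\<in>R. \<exists>l. coeff (g + h) k = c / ?f ^ l" by blast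
  qed
  have Ms: "smult c g \<in> ?M" if c: "c \<in> R" and M: "g \<in> ?M" for c g
    unfolding fs_module_def mem_Collect_eq
  proof
    fix k
    obtain d l where "d \<in> R" and e: "coeff g k = d / ?f ^ l"
      using M unfolding fs_module_def by blast
    then have "c * d \<in> R" "coeff (smult c g) k = (c * d) / ?f ^ l" using c e by (auto intro: R_mult)
    then show "\<exists>c'\<in>R. \<exists>l. coeff (smult c g) k = c' / ?f ^ l" by blast
  qed
  have Mf: "smult (1 / ?f) g \<in> ?M" if M: "g \<in> ?M" for g
    unfolding fs_module_def mem_Collect_eq
  proof
    fix k
    obtain d l where "d \<in> R" and e: "coeff g k = d / ?f ^ l"
      using M unfolding fs_module_def by blast
    then have "d \<in> R" "coeff (smult (1 / ?f) g) k = d / ?f ^ Suc l" using e by auto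
    then show "\<exists>c'\<in>R. \<exists>l. coeff (smult (1 / ?f) g) k = c' / ?f ^ l" by blast
  qed
  have Mp: "pCons 0 g \<in> ?M" if "g \<in> ?M" for g
    using that R_0 by (force simp: fs_module_def coeff_pCons split: nat.split)
  have Md: "map_poly (mfrac_deriv i) g \<in> ?M" if M: "g \<in> ?M" for g i
    unfolding fs_module_def mem_Collect_eq
  proof
    fix k
    obtain d l where d: "d \<in> R" and e: "coeff g k = d / ?f ^ l"
      using M unfolding fs_module_def by blast
    let ?c = "mfrac_deriv i d * ?f ^ l + - (d * mfrac_deriv i (?f ^ l))"
    have "?c \<in> R" by (intro R_add R_mult R_uminus R_deriv pw d)
    moreover have "coeff (map_poly (mfrac_deriv i) g) k = ?c / ?f ^ (l + l)"
      using f by (simp add: e mfrac_deriv_divide power_add)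
    ultimately show "\<exists>c\<in>R. \<exists>l. coeff (map_poly (mfrac_deriv i) g) k = c / ?f ^ l" by blast
  qed
  have MD: "fs_deriv ?f i g \<in> ?M" if "g \<in> ?M" for i g
  proof -
    have "smult (mfrac_deriv i ?f) (smult (1 / ?f) (pCons 0 g)) \<in> ?M"
      by (intro Ms Mf Mp R_deriv that assms)
    then show ?thesis unfolding fs_deriv_alt by (intro Ma Md that) simp
  qed
  have Mpow: "op_power (fs_deriv ?f) \<beta> g \<in> ?M" if "g \<in> ?M" for \<beta> g
    by (induction \<beta> rule: exp_induct)
       (simp_all only: op_power_step[of "fs_deriv ?f", OF fs_deriv_commute] that MD op_power_0)
  have Msum: "(\<And>x. x \<in> A \<Longrightarrow> t x \<in> ?M) \<Longrightarrow> sum t A \<in> ?M" for t and A :: "'b set"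
    by (induction A rule: infinite_finite_induct) (auto intro: M0 Ma)
  have Msum': "(\<And>x. x \<in> A \<Longrightarrow> t x \<in> ?M) \<Longrightarrow> sum t A \<in> ?M" for t and A :: "nat set"
    by (induction A rule: infinite_finite_induct) (auto intro: M0 Ma)
  have W: "weyl_act smult (fs_deriv ?f) Q g \<in> ?M" if "Q \<in> weyl_over R" for Q
    unfolding weyl_act_def using that assms
    by (intro Msum Ms Mpow) (auto simp: weyl_over_def)
  have Ms': "[:0, 1:] ^ k * g \<in> ?M" if "g \<in> ?M" for k g
    by (induction k) (use that Mp in \<open>simp_all\<close>)
  show ?thesis
    unfolding fs_act_def using assms by (intro Msum' Ms' W) (auto simp: weyl_s_over_def)
qed

lemma one_in_fs_module: "coeff_ring R \<Longrightarrow> 1 \<in> fs_module R f"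
  by (auto simp: fs_module_def coeff_ring_def coeff_1 intro!: exI[of _ 0])


section \<open>Left ideals and \<open>b\<close>-functions\<close>

abbreviation D_s :: "'n::{finite,linorder} weyl_s set" where
  "D_s \<equiv> weyl_s_over polynomials"

definition left_ideal :: "'n::{finite,linorder} weyl_s set \<Rightarrow> bool" where
  "left_ideal I \<longleftrightarrow> I \<subseteq> D_s \<and> 0 \<in> I \<and> (\<forall>P\<in>I. \<forall>Q\<in>I. P + Q \<in> I) \<and> (\<forall>P\<in>D_s. \<forall>Q\<in>I. P * Q \<in> I)"

definition left_ideal_sum :: "'n::{finite,linorder} weyl_s set \<Rightarrow> 'n weyl_s set \<Rightarrow> 'n weyl_s set" where
  "left_ideal_sum I J = {P + Q | P Q. P \<in> I \<and> Q \<in> J}"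

definition left_ideal_quot :: "'n::{finite,linorder} weyl_s set \<Rightarrow> 'n weyl_s \<Rightarrow> 'n weyl_s set" where
  "left_ideal_quot I q = {P \<in> D_s. q * P \<in> I}"

definition Ann_fs :: "'n::{finite,linorder} mpoly \<Rightarrow> 'n weyl_s set" where
  "Ann_fs f = {P \<in> D_s. fs_act f P 1 = 0}"

definition of_spoly :: "complex poly \<Rightarrow> 'n::{finite,linorder} mfrac poly" where
  "of_spoly b = map_poly (\<lambda>c. to_fract (Const c)) b"

text \<open>
  Monic of minimal degree with \<open>P f \<cdot> f\<^sup>s = b \<cdot> f\<^sup>s\<close> for some \<open>P\<close> in \<open>weyl_s_over R\<close>. The global
  \<open>b\<close>-function is used as a predicate, so that its existence (Bernstein's theorem) need not be
  established to name it; a global \<open>b\<close>-function yields the local ones, which are taken as values.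
\<close>

definition b_function_over ::
  "'n::{finite,linorder} mfrac set \<Rightarrow> 'n mpoly \<Rightarrow> complex poly \<Rightarrow> bool" where
  "b_function_over R f b \<longleftrightarrow>
     is_arg_min degree
       (\<lambda>b. lead_coeff b = 1 \<and>
            (\<exists>P\<in>weyl_s_over R. fs_act f (P * of_mpoly f) 1 = of_spoly b)) b"

definition is_bernstein_sato :: "'n::{finite,linorder} mpoly \<Rightarrow> complex poly \<Rightarrow> bool" where
  "is_bernstein_sato f b \<longleftrightarrow> b_function_over polynomials f b"

definition local_b_function :: "'n::{finite,linorder} mpoly \<Rightarrow> complex ^ 'n::{finite,linorder} \<Rightarrow> complex poly" where
  "local_b_function f p = (THE b. b_function_over (local_ring p) f b)"

definition zero_locus :: "'n::{finite,linorder} mpoly set \<Rightarrow> (complex ^ 'n::{finite,linorder}) set" where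
  "zero_locus A = {p. \<forall>g\<in>A. mpoly_eval p g = 0}"

definition I_alpha :: "'n::{finite,linorder} weyl_s set \<Rightarrow> complex \<Rightarrow> nat \<Rightarrow> 'n weyl_s set" where
  "I_alpha I \<alpha> i =
     left_ideal_sum (left_ideal_quot I ((s_var + of_mpoly (Const \<alpha>)) ^ i))
       (left_ideal hull {s_var + of_mpoly (Const \<alpha>)})"

end

theory Submission
  imports Defs
begin

text \<open>
  Write \<open>N\<^sub>R = R[\<partial>][s] f \<cdot> f\<^sup>s\<close> for the submodule generated by \<open>f \<cdot> f\<^sup>s\<close> over the coefficient ring
  \<open>R\<close>. The ideal \<open>I\<close> consists of the operators \<open>Q\<close> with \<open>Q f\<^sup>s\<close> in \<open>N\<close> for polynomial coefficients
  (\<open>mem_Ann_plus_f_iff\<close>), and a polynomial \<open>c(s)\<close> is a multiple of the local \<open>b\<close>-function at \<open>p\<close>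
  exactly when \<open>c \<cdot> f\<^sup>s\<close> lies in \<open>N\<close> for the local ring. The two submodules are linked by clearing
  denominators: \<open>u\<close> is in the local one iff \<open>h u\<close> is in the global one for some polynomial \<open>h\<close> with
  \<open>h(p) \<noteq> 0\<close> (\<open>mem_local_iff\<close>). The local \<open>b\<close>-function exists because the global one is a candidate
  for it.

  It remains to show that \<open>(s + \<alpha>)\<^sup>i\<^sup>+\<^sup>1\<close> fails to divide \<open>b\<^sub>p\<close> iff some \<open>g\<close> in \<open>I\<^sub>\<alpha>\<^sub>,\<^sub>i \<inter> \<complex>[x]\<close> does not
  vanish at \<open>p\<close>.

  If it fails to divide, then \<open>(s + \<alpha>)\<^sup>i c\<close> is a multiple of \<open>b\<^sub>p\<close> for some \<open>c\<close> with \<open>c(-\<alpha>) \<noteq> 0\<close>.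
  So \<open>h c\<close> is in \<open>I : (s + \<alpha>)\<^sup>i\<close> for some \<open>h\<close> with \<open>h(p) \<noteq> 0\<close>, and modulo \<open>s + \<alpha>\<close> it equals
  \<open>h c(-\<alpha>)\<close>, which is the required \<open>g\<close>.

  Conversely, \<open>g\<close> in \<open>I\<^sub>\<alpha>\<^sub>,\<^sub>i\<close> gives \<open>(s + \<alpha>)\<^sup>i g = U + V (s + \<alpha>)\<^sup>i\<^sup>+\<^sup>1\<close> with \<open>U\<close> in \<open>I\<close>. If \<open>g(p) \<noteq> 0\<close>
  and \<open>b\<^sub>p = (s + \<alpha>)\<^sup>i\<^sup>+\<^sup>1 d\<close>, then dividing by \<open>g\<close> and multiplying by the central element \<open>d\<close> makes
  the last term a left multiple of \<open>b\<^sub>p\<close>. Hence \<open>(s + \<alpha>)\<^sup>i d \<cdot> f\<^sup>s\<close> is in the local submodule, which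
  contradicts the minimality of \<open>b\<^sub>p\<close>.
\<close>

section \<open>Operators with coefficients in a subring\<close>

lemma (in coeff_ring) weyl_rep_self: "weyl_rep R wscale wder"
  by unfold_locales
     (simp_all add: wscale_add wscale_add_left wscale_mult wder_add wder_wscale wder_commute)

lemma pm_induct_over [consumes 1, case_names zero single add]:
  fixes P :: "'a \<Rightarrow>\<^sub>0 'b::comm_monoid_add"
  assumes P: "\<forall>k. Poly_Mapping.lookup P k \<in> A"
    and z: "Q 0" and s: "\<And>k a. a \<in> A \<Longrightarrow> Q (Poly_Mapping.single k a)"
    and a: "\<And>S T. Q S \<Longrightarrow> Q T \<Longrightarrow> Q (S + T)"
  shows "Q P"
proof -
  have "finite B \<Longrightarrow> Q (\<Sum>k\<in>B. Poly_Mapping.single k (Poly_Mapping.lookup P k))" for B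
    by (induction B rule: finite_induct) (use P in \<open>auto intro: z s a\<close>)
  from this[of "Poly_Mapping.keys P"] show ?thesis by (simp add: pm_sum_single)
qed

context coeff_ring
begin

interpretation self: weyl_rep R wscale wder by (rule weyl_rep_self)

lemma weyl_s_over_0: "0 \<in> weyl_s_over R"
  by (simp add: weyl_s_over_def self.weyl_over_0)

lemma weyl_s_over_add: "P \<in> weyl_s_over R \<Longrightarrow> Q \<in> weyl_s_over R \<Longrightarrow> P + Q \<in> weyl_s_over R"
  by (simp add: weyl_s_over_def lookup_add self.weyl_over_add)

lemma weyl_s_over_single: "P \<in> weyl_over R \<Longrightarrow> Poly_Mapping.single k P \<in> weyl_s_over R"
  by (simp add: weyl_s_over_def lookup_single when_def self.weyl_over_0)

lemma weyl_s_over_induct [consumes 1, case_names zero single add]: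
  assumes "P \<in> weyl_s_over R" and "Q 0"
    and "\<And>k S. S \<in> weyl_over R \<Longrightarrow> Q (Poly_Mapping.single k S)"
    and "\<And>S T. Q S \<Longrightarrow> Q T \<Longrightarrow> Q (S + T)"
  shows "Q P"
  using assms unfolding weyl_s_over_def mem_Collect_eq by (rule pm_induct_over)

lemma weyl_s_over_mult:
  assumes "P \<in> weyl_s_over R" "Q \<in> weyl_s_over R"
  shows "P * Q \<in> weyl_s_over R"
  using assms(1)
proof (induction P rule: weyl_s_over_induct)
  case (single k S)
  from assms(2) show ?case
    by (induction Q rule: weyl_s_over_induct)
       (simp_all add: weyl_s_over_0 mult_single weyl_s_over_single self.weyl_over_mult single
          weyl_s_over_add distrib_left)
qed (simp_all add: weyl_s_over_0 weyl_s_over_add distrib_right)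

lemma weyl_s_over_function: "c \<in> R \<Longrightarrow> Poly_Mapping.single 0 (wfun c) \<in> weyl_s_over R"
  by (simp add: weyl_s_over_single wfun_def self.weyl_over_wterm)

lemma weyl_s_over_of_mpoly: "to_fract g \<in> R \<Longrightarrow> of_mpoly g \<in> weyl_s_over R"
  by (simp add: of_mpoly_def weyl_s_over_function)

lemma weyl_s_over_s_var: "s_var \<in> weyl_s_over R"
  by (simp add: s_var_def weyl_s_over_single one_weyl_def self.weyl_over_wterm R_1)

end

lemma weyl_s_over_mono: "R \<subseteq> S \<Longrightarrow> weyl_s_over R \<subseteq> weyl_s_over S"
  by (auto simp: weyl_s_over_def weyl_over_def)

lemma of_mpoly_0 [simp]: "of_mpoly 0 = 0"
  by (simp add: of_mpoly_def wfun_def)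

lemma of_mpoly_1 [simp]: "of_mpoly 1 = 1"
  by (simp add: of_mpoly_def wfun_1)

lemma of_mpoly_add: "of_mpoly (g + h) = of_mpoly g + of_mpoly h"
  by (simp add: of_mpoly_def wfun_add single_add)

lemma of_mpoly_mult: "of_mpoly (g * h) = of_mpoly g * of_mpoly h"
  by (simp add: of_mpoly_def wfun_times mult_single)

lemma Const_0 [simp]: "Const 0 = 0" by (simp add: Const_def)
lemma Const_1 [simp]: "Const 1 = 1" by (simp add: Const_def)
lemma Const_add: "Const (c + d) = Const c + Const d" by (simp add: Const_def single_add)
lemma Const_mult: "Const (c * d) = Const c * Const d" by (simp add: Const_def mult_single)
lemma mpoly_eval_Const [simp]: "mpoly_eval p (Const c) = c" by (simp add: Const_def mpoly_eval_single)

lemma commutes_mult: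
  fixes a x y :: "'a::semigroup_mult"
  assumes "a * x = x * a" "a * y = y * a"
  shows "a * (x * y) = x * y * a"
proof -
  have "a * (x * y) = (x * a) * y" by (simp only: assms(1) mult.assoc[symmetric])
  also have "\<dots> = x * y * a" by (simp only: assms(2) mult.assoc)
  finally show ?thesis .
qed

lemma Const_central: "of_mpoly (Const c) * P = P * of_mpoly (Const c)"
proof (induction P rule: pm_induct)
  case (single k P)
  have "wfun (to_fract (Const c)) * P = P * wfun (to_fract (Const c))"
  proof (induction P rule: weyl_induct)
    case (wterm d \<beta>)
    have "wfun (to_fract (Const c)) * wterm 1 \<beta> = wterm 1 \<beta> * wfun (to_fract (Const c))"
    proof (induction \<beta> rule: exp_induct)
      case zero
      show ?case by (simp add: wfun_def[symmetric] wfun_1)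
    next
      case (step i \<beta>)
      show ?case
        unfolding wterm_eq wfun_1 mult_1_left by (rule commutes_mult[OF weyl_relations(5) step])
    qed
    moreover have "wfun (to_fract (Const c)) * wfun d = wfun d * wfun (to_fract (Const c))"
      by (simp add: wfun_times[symmetric] mult.commute)
    ultimately have "wfun (to_fract (Const c)) * (wfun d * wterm 1 \<beta>)
        = wfun d * wterm 1 \<beta> * wfun (to_fract (Const c))"
      by (rule commutes_mult[rotated])
    then show ?case by (simp add: wfun_mult[of d])
  qed (simp add: distrib_left distrib_right)
  then show ?case by (simp add: of_mpoly_def mult_single)
qed (simp add: distrib_left distrib_right)


section \<open>Polynomials in the central variable\<close>

text \<open>
  The value of \<open>c\<close> at \<open>s_var\<close>, by Horner's scheme: \<open>poly\<close> does not apply, since the operators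
  do not form a commutative ring.
\<close>

definition of_cpoly :: "complex poly \<Rightarrow> 'n::{finite,linorder} weyl_s" where
  "of_cpoly c = fold_coeffs (\<lambda>a P. of_mpoly (Const a) + s_var * P) c 0"

lemma of_cpoly_0 [simp]: "of_cpoly 0 = 0"
  by (simp add: of_cpoly_def)

lemma of_cpoly_pCons [simp]: "of_cpoly (pCons a c) = of_mpoly (Const a) + s_var * of_cpoly c"
  by (cases "c = 0"; cases "a = 0") (simp_all add: of_cpoly_def)

lemma of_cpoly_1 [simp]: "of_cpoly 1 = 1"
  by (simp add: one_pCons)

lemma of_cpoly_add: "of_cpoly (c + d) = of_cpoly c + of_cpoly d"
  by (induction c d rule: poly_induct2) (simp_all add: Const_add of_mpoly_add distrib_left)

lemma of_cpoly_smult: "of_cpoly (smult a c) = of_mpoly (Const a) * of_cpoly c"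
proof (induction c)
  case (pCons b c)
  have "of_mpoly (Const a) * (s_var * of_cpoly c) = (s_var :: 'a weyl_s) * of_cpoly (smult a c)"
    unfolding pCons.IH by (simp only: Const_central[of a s_var] mult.assoc[symmetric])
  then show ?case
    by (simp only: smult_pCons of_cpoly_pCons Const_mult of_mpoly_mult distrib_left)
qed simp

lemma of_cpoly_mult: "of_cpoly (c * d) = of_cpoly c * of_cpoly d"
  by (induction c) (simp_all add: of_cpoly_add of_cpoly_smult distrib_right mult.assoc)

lemma of_cpoly_power: "of_cpoly (c ^ n) = of_cpoly c ^ n"
  by (induction n) (simp_all add: of_cpoly_mult)

lemma of_cpoly_central: "of_cpoly c * P = P * of_cpoly c"
proof (induction c)
  case (pCons a c)
  have "s_var * of_cpoly c * P = P * (s_var * of_cpoly c)"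
    by (rule commutes_mult[symmetric, OF s_var_central[symmetric] pCons.IH[symmetric]])
  then show ?case by (simp add: distrib_left distrib_right Const_central)
qed simp

lemma of_spoly_0 [simp]: "of_spoly 0 = 0"
  by (simp add: of_spoly_def)

lemma of_spoly_pCons: "of_spoly (pCons a c) = pCons (to_fract (Const a)) (of_spoly c)"
  by (rule poly_eqI) (simp add: of_spoly_def coeff_map_poly coeff_pCons split: nat.split)

lemma of_spoly_1 [simp]: "of_spoly 1 = 1"
  by (simp add: one_pCons of_spoly_pCons)

lemma fs_act_of_mpoly: "fs_act f (of_mpoly g) u = smult (to_fract g) u"
  by (simp add: of_mpoly_def fs_act_single wfun_def fs.act_wterm)

lemma fs_act_function: "fs_act f (Poly_Mapping.single 0 (wfun c)) u = smult c u"
  by (simp add: fs_act_single wfun_def fs.act_wterm)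

lemma fs_act_s_var: "fs_act f s_var u = [:0, 1:] * u"
  unfolding s_var_def fs_act_single one_weyl_def fs.act_1 by simp

lemma fs_act_0 [simp]: "fs_act f 0 u = 0"
  by (simp add: fs_act_def)

text \<open>
  This identifies the polynomials in \<open>s\<close> that occur as operators with those that occur as
  coordinates of elements of the module.
\<close>

lemma fs_act_of_cpoly: "fs_act f (of_cpoly c) u = of_spoly c * u"
  by (induction c) (simp_all add: of_spoly_pCons fs_act_add_left fs_act_mult fs_act_of_mpoly fs_act_s_var)

lemma of_spoly_add: "of_spoly (c + d) = of_spoly c + of_spoly d"
  by (rule poly_eqI) (simp add: of_spoly_def coeff_map_poly Const_add)

lemma of_spoly_mult:
  "(of_spoly (c * d) :: 'n::{finite,linorder} mfrac poly) = of_spoly c * of_spoly d"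
  using fs_act_of_cpoly[of "0 :: 'n mpoly" "c * d" 1]
  by (simp add: of_cpoly_mult fs_act_mult fs_act_of_cpoly)

lemma fs_act_of_spoly_mult: "fs_act f P (of_spoly c * u) = of_spoly c * fs_act f P u"
proof -
  have "fs_act f P (fs_act f (of_cpoly c) u) = fs_act f (of_cpoly c) (fs_act f P u)"
    by (simp only: fs_act_mult[symmetric] of_cpoly_central)
  then show ?thesis by (simp only: fs_act_of_cpoly)
qed

lemma (in coeff_ring) of_cpoly_closed:
  assumes "polynomials \<subseteq> R"
  shows "of_cpoly c \<in> weyl_s_over R"
proof (induction c)
  case (pCons a c)
  have "to_fract (Const a) \<in> R" using assms by (auto simp: polynomials_def)
  with pCons show ?case
    by (simp add: weyl_s_over_add weyl_s_over_mult weyl_s_over_of_mpoly weyl_s_over_s_var)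
qed (simp add: weyl_s_over_0)


section \<open>The submodule generated by \<open>f \<cdot> f\<^sup>s\<close>\<close>

definition f_submodule :: "'n::{finite,linorder} mfrac set \<Rightarrow> 'n mpoly \<Rightarrow> 'n mfrac poly set" where
  "f_submodule R f = (\<lambda>P. fs_act f (P * of_mpoly f) 1) ` weyl_s_over R"

lemma b_function_over_iff:
  "b_function_over R f b \<longleftrightarrow>
     is_arg_min degree (\<lambda>c. lead_coeff c = 1 \<and> of_spoly c \<in> f_submodule R f) b"
proof -
  have "(\<exists>P\<in>weyl_s_over R. fs_act f (P * of_mpoly f) 1 = of_spoly c) \<longleftrightarrow> of_spoly c \<in> f_submodule R f" for c
    by (auto simp: f_submodule_def image_iff) metis
  then show ?thesis by (simp add: b_function_over_def)
qed

lemma f_submodule_mono: "R \<subseteq> S \<Longrightarrow> f_submodule R f \<subseteq> f_submodule S f"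
  unfolding f_submodule_def by (intro image_mono weyl_s_over_mono)

context coeff_ring
begin

lemma f_submodule_add:
  assumes "u \<in> f_submodule R f" "v \<in> f_submodule R f"
  shows "u + v \<in> f_submodule R f"
proof -
  obtain P Q where "P \<in> weyl_s_over R" "Q \<in> weyl_s_over R"
    and "u = fs_act f (P * of_mpoly f) 1" "v = fs_act f (Q * of_mpoly f) 1"
    using assms by (auto simp: f_submodule_def)
  then show ?thesis
    unfolding f_submodule_def
    by (intro image_eqI[of _ _ "P + Q"]) (simp_all add: distrib_right fs_act_add_left weyl_s_over_add)
qed

lemma f_submodule_act:
  assumes "Q \<in> weyl_s_over R" "u \<in> f_submodule R f"
  shows "fs_act f Q u \<in> f_submodule R f"
proof -
  obtain P where "P \<in> weyl_s_over R" "u = fs_act f (P * of_mpoly f) 1"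
    using assms by (auto simp: f_submodule_def)
  with assms(1) show ?thesis
    unfolding f_submodule_def
    by (intro image_eqI[of _ _ "Q * P"]) (simp_all add: mult.assoc fs_act_mult weyl_s_over_mult)
qed

lemma f_submodule_smult:
  assumes "c \<in> R" "u \<in> f_submodule R f"
  shows "smult c u \<in> f_submodule R f"
  using f_submodule_act[OF weyl_s_over_function assms(2), OF assms(1)] by (simp add: fs_act_function)

lemma f_submodule_of_spoly_mult:
  assumes "polynomials \<subseteq> R" "u \<in> f_submodule R f"
  shows "of_spoly c * u \<in> f_submodule R f"
  using f_submodule_act[OF of_cpoly_closed assms(2), OF assms(1)] by (simp add: fs_act_of_cpoly)

text \<open>
  Monic polynomials of minimal degree in an ideal of \<open>\<complex>[s]\<close> are unique: a non-zero difference of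
  two of them could be rescaled to a monic element of smaller degree.
\<close>

lemma b_function_over_unique:
  assumes R: "polynomials \<subseteq> R" and b: "b_function_over R f b" and c: "b_function_over R f c"
  shows "b = c"
proof (rule ccontr)
  assume "b \<noteq> c"
  define d where "d = b - c"
  have d0: "d \<noteq> 0" using \<open>b \<noteq> c\<close> by (simp add: d_def)
  have lb: "lead_coeff b = 1" "of_spoly b \<in> f_submodule R f"
    and lc: "lead_coeff c = 1" "of_spoly c \<in> f_submodule R f"
    and min: "\<And>e. lead_coeff e = 1 \<Longrightarrow> of_spoly e \<in> f_submodule R f \<Longrightarrow> degree b \<le> degree e"
    and deg: "degree b = degree c"
    using b c unfolding b_function_over_iff is_arg_min_linorder by (auto intro: antisym)
  have "degree d \<noteq> degree b"
  proof
    assume "degree d = degree b"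
    then have "lead_coeff d = 0" using lb lc deg by (simp add: d_def)
    with d0 show False by simp
  qed
  moreover have "degree d \<le> degree b" using degree_diff_le_max[of b c] deg by (simp add: d_def)
  ultimately have less: "degree d < degree b" by simp
  define e where "e = smult (1 / lead_coeff d) d"
  have "e = [:1 / lead_coeff d:] * (b + [:-1:] * c)" by (simp add: e_def d_def)
  then have "of_spoly e = of_spoly [:1 / lead_coeff d:] * (of_spoly b + of_spoly [:-1:] * of_spoly c)"
    by (simp only: of_spoly_mult of_spoly_add)
  then have "of_spoly e \<in> f_submodule R f"
    using f_submodule_of_spoly_mult[OF R] f_submodule_add lb lc by metis
  moreover have "lead_coeff e = 1" "degree e = degree d" using d0 by (simp_all add: e_def)
  ultimately show False using min[of e] less by simp
qed

end


section \<open>Clearing denominators\<close>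

lemma polynomials_subset_local_ring: "polynomials \<subseteq> local_ring p"
  by (auto simp: polynomials_def local_ring_def to_fract_def) (metis mpoly_eval_1 zero_neq_one)

lemma inverse_in_local_ring:
  assumes "mpoly_eval p h \<noteq> 0"
  shows "1 / to_fract h \<in> local_ring p"
proof -
  have "1 / to_fract h = Fract 1 h" by (simp add: to_fract_def One_fract_def)
  with assms show ?thesis unfolding local_ring_def by blast
qed

lemma local_weyl_s_clear_denominators:
  fixes P :: "'n::{finite,linorder} weyl_s"
  assumes "P \<in> weyl_s_over (local_ring p)"
  obtains h where "mpoly_eval p h \<noteq> 0" "of_mpoly h * P \<in> D_s"
proof -
  interpret L: coeff_ring "local_ring p" by (rule coeff_ring_local_ring)
  interpret C: coeff_ring polynomials by (rule coeff_ring_polynomials)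
  have g: "of_mpoly g \<in> D_s" for g :: "'n mpoly"
    by (rule C.weyl_s_over_of_mpoly) (simp add: polynomials_def)
  have sum: "\<exists>h. mpoly_eval p h \<noteq> 0 \<and> of_mpoly h * (S + T) \<in> D_s"
    if S: "\<exists>h. mpoly_eval p h \<noteq> 0 \<and> of_mpoly h * S \<in> D_s"
      and T: "\<exists>h. mpoly_eval p h \<noteq> 0 \<and> of_mpoly h * T \<in> D_s" for S T :: "'n weyl_s"
  proof -
    obtain h k where h: "mpoly_eval p h \<noteq> 0" "of_mpoly h * S \<in> D_s"
      and k: "mpoly_eval p k \<noteq> 0" "of_mpoly k * T \<in> D_s" using S T by auto
    have "of_mpoly (h * k) * (S + T) = of_mpoly k * (of_mpoly h * S) + of_mpoly h * (of_mpoly k * T)"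
      unfolding mult.assoc[symmetric] of_mpoly_mult[symmetric] distrib_left mult.commute[of k h] ..
    moreover have "\<dots> \<in> D_s" by (intro C.weyl_s_over_add C.weyl_s_over_mult g h k)
    ultimately show ?thesis using h k by (intro exI[of _ "h * k"]) (simp add: mpoly_eval_mult)
  qed
  have "\<exists>h. mpoly_eval p h \<noteq> 0 \<and> of_mpoly h * P \<in> D_s"
    using assms
  proof (induction P rule: L.weyl_s_over_induct)
    case zero
    show ?case using C.weyl_s_over_0 by (intro exI[of _ 1]) simp
  next
    case (single k S)
    then show ?case
    proof (induction S rule: weyl_over_induct)
      case zero
      show ?case by (rule L.R_0)
    next
      case (wterm c \<beta>)
      then obtain a b where c: "c = Fract a b" and b: "mpoly_eval p b \<noteq> 0"
        by (auto simp: local_ring_def)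
      have "b \<noteq> 0" using b by auto
      then have "to_fract b * c = to_fract a" by (simp add: c to_fract_def eq_fract)
      then have "of_mpoly b * Poly_Mapping.single k (wterm c \<beta>)
          = Poly_Mapping.single k (wterm (to_fract a) \<beta>)"
        by (simp add: of_mpoly_def mult_single wfun_mult)
      moreover have "wterm (to_fract a) \<beta> \<in> weyl_over polynomials"
        using C.R_0 by (simp add: weyl_over_def lookup_single when_def polynomials_def)
      ultimately show ?case using b C.weyl_s_over_single by metis
    next
      case (add S T)
      then show ?case by (simp add: single_add sum)
    next
      case (closed c d)
      then show ?case by (rule L.R_add)
    qed
  next
    case (add S T)
    then show ?case by (rule sum)
  qed
  then show thesis using that by blast
qed

text \<open>
  An operator has finitely many coefficients, hence a common denominator. It can be cleared from
  the left because denominators act on the module by plain multiplication.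
\<close>

lemma mem_local_iff:
  "u \<in> f_submodule (local_ring p) f \<longleftrightarrow>
     (\<exists>h. mpoly_eval p h \<noteq> 0 \<and> smult (to_fract h) u \<in> f_submodule polynomials f)"
    (is "?L \<longleftrightarrow> ?R")
proof
  interpret L: coeff_ring "local_ring p" by (rule coeff_ring_local_ring)
  {
    assume ?L
    then obtain P where P: "P \<in> weyl_s_over (local_ring p)" and u: "u = fs_act f (P * of_mpoly f) 1"
      by (auto simp: f_submodule_def)
    obtain h where h: "mpoly_eval p h \<noteq> 0" "of_mpoly h * P \<in> D_s"
      using local_weyl_s_clear_denominators[OF P] .
    have "smult (to_fract h) u = fs_act f ((of_mpoly h * P) * of_mpoly f) 1"
      by (simp add: u mult.assoc fs_act_mult fs_act_of_mpoly)
    with h show ?R by (auto simp: f_submodule_def)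
  }
  assume ?R
  then obtain h where h: "mpoly_eval p h \<noteq> 0" and u: "smult (to_fract h) u \<in> f_submodule polynomials f"
    by blast
  have "to_fract h \<noteq> 0" using h by auto
  then have "u = smult (1 / to_fract h) (smult (to_fract h) u)" by simp
  moreover have "smult (to_fract h) u \<in> f_submodule (local_ring p) f"
    using u f_submodule_mono[OF polynomials_subset_local_ring] by blast
  ultimately show ?L using L.f_submodule_smult inverse_in_local_ring[OF h] by metis
qed

lemma local_b_function_is_b_function:
  assumes "is_bernstein_sato f b"
  shows "b_function_over (local_ring p) f (local_b_function f p)"
proof -
  interpret L: coeff_ring "local_ring p" by (rule coeff_ring_local_ring)
  let ?Q = "\<lambda>c. lead_coeff c = 1 \<and> of_spoly c \<in> f_submodule (local_ring p) f"
  have "?Q b"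
    using assms f_submodule_mono[OF polynomials_subset_local_ring]
    by (auto simp: is_bernstein_sato_def b_function_over_iff is_arg_min_def)
  then obtain c where "?Q c" "\<And>e. ?Q e \<Longrightarrow> degree c \<le> degree e"
    using ex_has_least_nat[of ?Q b degree] by blast
  then have "b_function_over (local_ring p) f c"
    by (simp add: b_function_over_iff is_arg_min_linorder)
  then show ?thesis
    unfolding local_b_function_def
    by (rule theI) (rule L.b_function_over_unique[OF polynomials_subset_local_ring _ \<open>b_function_over _ f c\<close>])
qed


section \<open>The ideals \<open>I\<close> and \<open>I\<^sub>\<alpha>\<^sub>,\<^sub>i\<close>\<close>

lemma left_ideal_hull_singleton:
  fixes g :: "'n::{finite,linorder} weyl_s"
  assumes g: "g \<in> D_s"
  shows "left_ideal hull {g} = {P * g | P. P \<in> D_s}"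
proof (rule hull_unique)
  interpret C: coeff_ring polynomials by (rule coeff_ring_polynomials)
  have "(1 :: 'n weyl_s) \<in> D_s"
    using C.weyl_s_over_of_mpoly[of 1] C.R_1 by simp
  then show "{g} \<subseteq> {P * g | P. P \<in> D_s}"
    by (metis (mono_tags, lifting) mem_Collect_eq mult_1_left singletonD subsetI)
  show "left_ideal {P * g | P. P \<in> D_s}"
    unfolding left_ideal_def
  proof (intro conjI ballI)
    show "{P * g | P. P \<in> D_s} \<subseteq> D_s" using g C.weyl_s_over_mult by blast
    show "0 \<in> {P * g | P. P \<in> D_s}" using C.weyl_s_over_0 by force
  next
    fix P Q assume "P \<in> {P * g | P. P \<in> D_s}" "Q \<in> {P * g | P. P \<in> D_s}"
    then obtain S T where "S \<in> D_s" "T \<in> D_s" "P + Q = (S + T) * g"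
      by (auto simp: distrib_right)
    then show "P + Q \<in> {P * g | P. P \<in> D_s}"
      using C.weyl_s_over_add by blast
  next
    fix P Q :: "'n weyl_s" assume "P \<in> D_s" "Q \<in> {P * g | P. P \<in> D_s}"
    then obtain S where "P \<in> D_s" "S \<in> D_s" "P * Q = (P * S) * g"
      by (auto simp: mult.assoc)
    then show "P * Q \<in> {P * g | P. P \<in> D_s}"
      using C.weyl_s_over_mult by blast
  qed
qed (auto simp: left_ideal_def)

text \<open>Two operators with the same value on \<open>f\<^sup>s\<close> differ by an element of the annihilator.\<close>

lemma mem_Ann_plus_f_iff:
  fixes f :: "'n::{finite,linorder} mpoly"
  shows
  "Q \<in> left_ideal_sum (Ann_fs f) (left_ideal hull {of_mpoly f}) \<longleftrightarrow>
     Q \<in> D_s \<and> fs_act f Q 1 \<in> f_submodule polynomials f"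
    (is "?L \<longleftrightarrow> ?R")
proof
  interpret C: coeff_ring polynomials by (rule coeff_ring_polynomials)
  have f: "of_mpoly f \<in> D_s" by (rule C.weyl_s_over_of_mpoly) (simp add: polynomials_def)
  {
    assume ?L
    then obtain A P where "A \<in> Ann_fs f" "P \<in> D_s" "Q = A + P * of_mpoly f"
      by (auto simp: left_ideal_sum_def left_ideal_hull_singleton[OF f])
    with f show ?R
      by (auto simp: Ann_fs_def fs_act_add_left f_submodule_def C.weyl_s_over_add C.weyl_s_over_mult)
  }
  assume R: ?R
  then obtain P where P: "P \<in> D_s" and e: "fs_act f Q 1 = fs_act f (P * of_mpoly f) 1"
    by (auto simp: f_submodule_def)
  have m: "of_mpoly (Const (-1)) * S = - S" for S :: "'n weyl_s"
    using of_mpoly_add[of "Const 1" "Const (-1)"] Const_add[of 1 "-1"]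
    by (metis Const_0 Const_1 add.right_inverse mult_minus1 neg_eq_iff_add_eq_0 of_mpoly_0 of_mpoly_1)
  have "of_mpoly (Const (-1)) * (P * of_mpoly f) \<in> D_s"
    by (intro C.weyl_s_over_mult P f C.weyl_s_over_of_mpoly) (simp add: polynomials_def)
  then have "Q + - (P * of_mpoly f) \<in> D_s"
    using R C.weyl_s_over_add unfolding m by blast
  moreover have "fs_act f (Q + - (P * of_mpoly f)) 1 = 0"
    using fs_act_add_left[of f "Q + - (P * of_mpoly f)" "P * of_mpoly f" 1] e by simp
  ultimately have "Q + - (P * of_mpoly f) \<in> Ann_fs f" by (simp add: Ann_fs_def)
  moreover have "Q = (Q + - (P * of_mpoly f)) + P * of_mpoly f" by simp
  ultimately show ?L
    using P unfolding left_ideal_sum_def left_ideal_hull_singleton[OF f] by blast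
qed

lemma s_shift_eq: "s_var + of_mpoly (Const \<alpha>) = of_cpoly [:\<alpha>, 1:]"
  by (simp add: add.commute)

lemma mem_I_alpha_iff:
  fixes f :: "'n::{finite,linorder} mpoly"
  assumes I: "I = left_ideal_sum (Ann_fs f) (left_ideal hull {of_mpoly f})"
  shows "S \<in> I_alpha I \<alpha> i \<longleftrightarrow>
    (\<exists>Q\<in>D_s. \<exists>V\<in>D_s. S = Q + V * of_cpoly [:\<alpha>, 1:] \<and>
       of_spoly ([:\<alpha>, 1:] ^ i) * fs_act f Q 1 \<in> f_submodule polynomials f)"
proof -
  interpret C: coeff_ring polynomials by (rule coeff_ring_polynomials)
  have c: "(of_cpoly c :: 'n weyl_s) \<in> D_s" for c by (rule C.of_cpoly_closed) simp
  have "Q \<in> left_ideal_quot I (of_cpoly [:\<alpha>, 1:] ^ i) \<longleftrightarrow>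
      Q \<in> D_s \<and> of_spoly ([:\<alpha>, 1:] ^ i) * fs_act f Q 1 \<in> f_submodule polynomials f" for Q
    unfolding left_ideal_quot_def I mem_Collect_eq mem_Ann_plus_f_iff
    unfolding of_cpoly_power[symmetric] fs_act_mult fs_act_of_cpoly using C.weyl_s_over_mult c by blast
  then show ?thesis
    unfolding I_alpha_def left_ideal_sum_def s_shift_eq left_ideal_hull_singleton[OF c]
    by blast
qed


section \<open>Multiplicities\<close>

lemma order_reflect_gt_iff:
  fixes b :: "complex poly"
  assumes "b \<noteq> 0"
  shows "order \<alpha> (b \<circ>\<^sub>p [:0, -1:]) > i \<longleftrightarrow> [:\<alpha>, 1:] ^ Suc i dvd b"
proof -
  have inv: "c \<circ>\<^sub>p [:0, -1:] \<circ>\<^sub>p [:0, -1:] = c" for c :: "complex poly"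
    by (simp flip: pcompose_assoc add: pcompose_pCons pcompose_idR)
  have dvd: "c \<circ>\<^sub>p [:0, -1:] dvd d \<circ>\<^sub>p [:0, -1:]" if "c dvd d" for c d :: "complex poly"
    using that by (auto simp: dvd_def pcompose_mult)
  have pw: "[:\<alpha>, 1:] ^ n \<circ>\<^sub>p [:0, -1:] = (- [:-\<alpha>, 1:]) ^ n" for n
    by (induction n) (simp_all add: pcompose_mult pcompose_pCons pcompose_1 del: mult_pCons_left)
  have "b \<circ>\<^sub>p [:0, -1:] \<noteq> 0" using assms inv[of b] by (metis pcompose_0)
  then have "order \<alpha> (b \<circ>\<^sub>p [:0, -1:]) > i \<longleftrightarrow> [:-\<alpha>, 1:] ^ Suc i dvd b \<circ>\<^sub>p [:0, -1:]"
    by (simp add: order_divides Suc_le_eq del: power_Suc)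
  also have "\<dots> \<longleftrightarrow> ([:\<alpha>, 1:] ^ Suc i) \<circ>\<^sub>p [:0, -1:] dvd b \<circ>\<^sub>p [:0, -1:]"
    unfolding pw uminus_power_if by (simp only: minus_dvd_iff split: if_split) simp
  also have "\<dots> \<longleftrightarrow> [:\<alpha>, 1:] ^ Suc i dvd b"
    using dvd[of "[:\<alpha>, 1:] ^ Suc i" b] dvd[of "[:\<alpha>, 1:] ^ Suc i \<circ>\<^sub>p [:0, -1:]" "b \<circ>\<^sub>p [:0, -1:]"]
    unfolding inv by blast
  finally show ?thesis .
qed

lemma root_power_multiple:
  fixes b :: "complex poly"
  assumes "b \<noteq> 0" and "\<not> [:\<alpha>, 1:] ^ Suc i dvd b"
  obtains c e where "[:\<alpha>, 1:] ^ i * c = e * b" "poly c (-\<alpha>) \<noteq> 0"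
proof -
  obtain c where c: "b = [:- (-\<alpha>), 1:] ^ order (-\<alpha>) b * c" "\<not> [:- (-\<alpha>), 1:] dvd c"
    using order_decomp[OF assms(1)] by blast
  have le: "order (-\<alpha>) b \<le> i"
    using assms order_divides[of "-\<alpha>" "Suc i" b] by simp
  have "[:\<alpha>, 1:] ^ i * c = [:\<alpha>, 1:] ^ (i - order (-\<alpha>) b) * ([:\<alpha>, 1:] ^ order (-\<alpha>) b * c)"
    using le by (simp add: mult.assoc[symmetric] power_add[symmetric])
  also have "[:\<alpha>, 1:] ^ order (-\<alpha>) b * c = b" using c by simp
  finally show ?thesis using that c(2) by (simp add: poly_eq_0_iff_dvd)
qed

text \<open>
  If the multiplicity is at most \<open>i\<close>, reduction modulo \<open>s + \<alpha>\<close> of the cofactor \<open>c\<close> in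
  \<open>(s + \<alpha>)\<^sup>i c\<close> produces an element of \<open>I\<^sub>\<alpha>\<^sub>,\<^sub>i\<close> that is a polynomial in the \<open>x\<^sub>i\<close> alone.
\<close>

lemma nonvanishing_element:
  fixes f :: "'n::{finite,linorder} mpoly"
  assumes I: "I = left_ideal_sum (Ann_fs f) (left_ideal hull {of_mpoly f})"
    and c: "of_spoly ([:\<alpha>, 1:] ^ i * c) \<in> f_submodule (local_ring p) f" and nz: "poly c (-\<alpha>) \<noteq> 0"
  shows "p \<notin> zero_locus {g. of_mpoly g \<in> I_alpha I \<alpha> i}"
proof -
  interpret C: coeff_ring polynomials by (rule coeff_ring_polynomials)
  have cD: "(of_cpoly c :: 'n weyl_s) \<in> D_s" for c by (rule C.of_cpoly_closed) simp
  have gD: "of_mpoly g \<in> D_s" for g :: "'n mpoly" by (rule C.weyl_s_over_of_mpoly) (simp add: polynomials_def)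
  obtain h where h: "mpoly_eval p h \<noteq> 0"
    and hc: "smult (to_fract h) (of_spoly ([:\<alpha>, 1:] ^ i * c)) \<in> f_submodule polynomials f"
    using c unfolding mem_local_iff by blast
  define a where "a = poly c (-\<alpha>)"
  have "[:\<alpha>, 1:] dvd c - [:a:]"
    using poly_eq_0_iff_dvd[of "c - [:a:]" "-\<alpha>"] by (simp add: a_def)
  then obtain e where e: "c - [:a:] = [:\<alpha>, 1:] * e" by (rule dvdE)
  then have "[:a:] = c + [:-1:] * e * [:\<alpha>, 1:]" by (simp add: algebra_simps)
  then have "(of_mpoly (Const a) :: 'n weyl_s) = of_cpoly c + of_cpoly ([:-1:] * e) * of_cpoly [:\<alpha>, 1:]"
    using arg_cong[of "[:a:]" _ of_cpoly] of_cpoly_add of_cpoly_mult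
    by (metis add.right_neutral mult_zero_right of_cpoly_0 of_cpoly_pCons)
  then have g: "of_mpoly (h * Const a)
      = of_mpoly h * of_cpoly c + (of_mpoly h * of_cpoly ([:-1:] * e)) * of_cpoly [:\<alpha>, 1:]"
    by (simp only: of_mpoly_mult distrib_left mult.assoc)
  have "fs_act f (of_mpoly h * of_cpoly c) 1 = smult (to_fract h) (of_spoly c)"
    by (simp add: fs_act_mult fs_act_of_mpoly fs_act_of_cpoly)
  then have "of_spoly ([:\<alpha>, 1:] ^ i) * fs_act f (of_mpoly h * of_cpoly c) 1 \<in> f_submodule polynomials f"
    using hc by (simp only: of_spoly_mult mult_smult_right)
  with g have "of_mpoly (h * Const a) \<in> I_alpha I \<alpha> i"
    unfolding mem_I_alpha_iff[OF I] using C.weyl_s_over_mult gD cD by blast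
  moreover have "mpoly_eval p (h * Const a) \<noteq> 0" using h nz by (simp add: a_def mpoly_eval_mult)
  ultimately show ?thesis unfolding zero_locus_def by blast
qed

text \<open>
  Conversely, where some element of \<open>I\<^sub>\<alpha>\<^sub>,\<^sub>i \<inter> \<complex>[x]\<close> does not vanish, the factor \<open>(s + \<alpha>)\<^sup>i\<^sup>+\<^sup>1\<close> of a
  candidate for the local \<open>b\<close>-function can be lowered to \<open>(s + \<alpha>)\<^sup>i\<close>.
\<close>

lemma lower_multiplicity:
  fixes f :: "'n::{finite,linorder} mpoly"
  assumes I: "I = left_ideal_sum (Ann_fs f) (left_ideal hull {of_mpoly f})"
    and g: "of_mpoly g \<in> I_alpha I \<alpha> i" "mpoly_eval p g \<noteq> 0"
    and d: "of_spoly ([:\<alpha>, 1:] ^ Suc i * d) \<in> f_submodule (local_ring p) f"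
  shows "of_spoly ([:\<alpha>, 1:] ^ i * d) \<in> f_submodule (local_ring p) f"
proof -
  interpret L: coeff_ring "local_ring p" by (rule coeff_ring_local_ring)
  note sub = polynomials_subset_local_ring[of p]
  let ?s = "of_spoly [:\<alpha>, 1:] :: 'n mfrac poly" and ?si = "of_spoly ([:\<alpha>, 1:] ^ i) :: 'n mfrac poly"
    and ?d = "of_spoly d :: 'n mfrac poly"
  obtain Q V where V: "V \<in> D_s" and e: "of_mpoly g = Q + V * of_cpoly [:\<alpha>, 1:]"
    and Q: "?si * fs_act f Q 1 \<in> f_submodule polynomials f"
    using g(1) unfolding mem_I_alpha_iff[OF I] by blast
  have "fs_act f (of_mpoly g) 1 = fs_act f Q 1 + fs_act f V (?s * 1)"
    unfolding e fs_act_add_left fs_act_mult fs_act_of_cpoly ..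
  then have "smult (to_fract g) 1 = fs_act f Q 1 + ?s * fs_act f V 1"
    unfolding fs_act_of_mpoly fs_act_of_spoly_mult .
  then have "(?d * ?si) * smult (to_fract g) 1 = (?d * ?si) * (fs_act f Q 1 + ?s * fs_act f V 1)"
    by (rule arg_cong)
  then have "smult (to_fract g) (?si * ?d) = ?d * (?si * fs_act f Q 1) + (?s * ?si * ?d) * fs_act f V 1"
    by (simp add: algebra_simps)
  \<comment> \<open>The last term is \<open>V\<close> applied to the candidate, because polynomials in \<open>s\<close> are central.\<close>
  also have "(?s * ?si * ?d) * fs_act f V 1 = fs_act f V (of_spoly ([:\<alpha>, 1:] ^ Suc i * d))"
    using fs_act_of_spoly_mult[of f V "[:\<alpha>, 1:] ^ Suc i * d" 1]
    by (simp only: of_spoly_mult power_Suc mult_1_right)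
  finally have "smult (to_fract g) (of_spoly ([:\<alpha>, 1:] ^ i * d))
      = ?d * (?si * fs_act f Q 1) + fs_act f V (of_spoly ([:\<alpha>, 1:] ^ Suc i * d))"
    by (simp only: of_spoly_mult)
  moreover have "?d * (?si * fs_act f Q 1) \<in> f_submodule (local_ring p) f"
    using Q f_submodule_mono[OF sub] L.f_submodule_of_spoly_mult[OF sub] by blast
  moreover have "fs_act f V (of_spoly ([:\<alpha>, 1:] ^ Suc i * d)) \<in> f_submodule (local_ring p) f"
    using V weyl_s_over_mono[OF sub] L.f_submodule_act d by blast
  ultimately have "smult (to_fract g) (of_spoly ([:\<alpha>, 1:] ^ i * d)) \<in> f_submodule (local_ring p) f"
    using L.f_submodule_add by metis
  then have "smult (1 / to_fract g) (smult (to_fract g) (of_spoly ([:\<alpha>, 1:] ^ i * d)))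
      \<in> f_submodule (local_ring p) f"
    by (rule L.f_submodule_smult[OF inverse_in_local_ring[OF g(2)]])
  moreover have "to_fract g \<noteq> 0" using g(2) by auto
  ultimately show ?thesis by simp
qed

theorem theorem5p1:
  fixes f :: "'n::{finite,linorder} mpoly"
    and b :: "complex poly"
    and P :: "nat \<Rightarrow> 'n weyl_s"
    and I :: "'n weyl_s set"
    and \<alpha> :: complex
    and k m i :: nat
    and p :: "complex ^ 'n::{finite,linorder}"
  assumes "f \<noteq> 0"
    and "is_bernstein_sato f b"
    and "I = left_ideal_sum (Ann_fs f) (left_ideal hull {of_mpoly f})"
    and "\<forall>j\<in>{1..k}. P j \<in> D_s"
    and "I = left_ideal hull (P ` {1..k} \<union> {of_mpoly f})"
    and "poly (b \<circ>\<^sub>p [:0, -1:]) \<alpha> = 0"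
    and "m = order \<alpha> (b \<circ>\<^sub>p [:0, -1:])"
    and "i < m"
  shows "order \<alpha> (local_b_function f p \<circ>\<^sub>p [:0, -1:]) > i
    \<longleftrightarrow> p \<in> zero_locus {g. of_mpoly g \<in> I_alpha I \<alpha> i}"
proof -
  interpret L: coeff_ring "local_ring p" by (rule coeff_ring_local_ring)
  note I = assms(3)
  define bp where "bp = local_b_function f p"
  have monic: "lead_coeff bp = 1" and bp: "of_spoly bp \<in> f_submodule (local_ring p) f"
    and min: "\<And>c. lead_coeff c = 1 \<Longrightarrow> of_spoly c \<in> f_submodule (local_ring p) f \<Longrightarrow> degree bp \<le> degree c"
    using local_b_function_is_b_function[OF assms(2), of p]
    unfolding bp_def[symmetric] b_function_over_iff is_arg_min_linorder by auto
  have bp0: "bp \<noteq> 0" using monic by auto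
  have "p \<in> zero_locus {g. of_mpoly g \<in> I_alpha I \<alpha> i}" if dv: "[:\<alpha>, 1:] ^ Suc i dvd bp"
  proof (rule ccontr)
    assume "p \<notin> zero_locus {g. of_mpoly g \<in> I_alpha I \<alpha> i}"
    then obtain g where g: "of_mpoly g \<in> I_alpha I \<alpha> i" "mpoly_eval p g \<noteq> 0"
      by (auto simp: zero_locus_def)
    obtain d where d: "bp = [:\<alpha>, 1:] ^ Suc i * d" using dv by (rule dvdE)
    have d0: "d \<noteq> 0" using d bp0 by auto
    have "of_spoly ([:\<alpha>, 1:] ^ i * d) \<in> f_submodule (local_ring p) f"
      using lower_multiplicity[OF I g] bp d by simp
    moreover have "lead_coeff ([:\<alpha>, 1:] ^ i * d) = 1"
      using monic unfolding d lead_coeff_mult lead_coeff_power by simp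
    ultimately have "degree bp \<le> degree ([:\<alpha>, 1:] ^ i * d)" using min by blast
    then show False using d0 by (simp add: d degree_mult_eq degree_power_eq del: power_Suc)
  qed
  moreover have "p \<notin> zero_locus {g. of_mpoly g \<in> I_alpha I \<alpha> i}" if ndvd: "\<not> [:\<alpha>, 1:] ^ Suc i dvd bp"
  proof -
    obtain c e where c: "[:\<alpha>, 1:] ^ i * c = e * bp" "poly c (-\<alpha>) \<noteq> 0"
      using root_power_multiple[OF bp0 ndvd] .
    have "of_spoly ([:\<alpha>, 1:] ^ i * c) \<in> f_submodule (local_ring p) f"
      unfolding c(1) of_spoly_mult
      by (rule L.f_submodule_of_spoly_mult[OF polynomials_subset_local_ring bp])
    then show ?thesis using nonvanishing_element[OF I _ c(2)] by blast
  qed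
  ultimately show ?thesis
    unfolding bp_def[symmetric] order_reflect_gt_iff[OF bp0] by blast
qed

end
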